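(* Let $q$ be a prime power, let $n,d\in\mathbb{N}$ with $2\le d\le n$, let $G = \mathcal{G}_{q,n,d}$ be the generalized-Hamming graph, which is regular of degree $\Delta = \sum_{i=1}^{d-1} \binom{n}{i}(q-1)^i$, and let $\overline{G}$ be its complement. (1) If either $d=2$, or $(q,d)=(2,3)$, or $(q,d)=(2,n)$, then $$\vartheta(G) = -\frac{q^n\,\lambda_{\min}(G)}{\Delta-\lambda_{\min}(G)}, \qquad \vartheta(\overline{G}) = 1-\frac{\Delta}{\lambda_{\min}(G)},$$ where $\lambda_{\min}(G)$ is the smallest eigenvalue of the adjacency matrix of $G$. (2) If either ($q=2$, $d=n-1$ and $n$ is even), or $d=n$, then $$\vartheta(G) = \frac{q^n-\Delta+\lambda_2(G)}{1+\lambda_2(G)}, \qquad \vartheta(\overline{G}) = \frac{q^n\,(1+\lambda_2(G))}{q^n-\Delta+\lambda_2(G)},$$ where $\lambda_2(G)$ is the second largest eigenvalue of the adjacency matrix of $G$.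
   Context: For a prime power $q$ and $n,d\in\mathbb{N}$ with $2\le d\le n$, the generalized-Hamming graph $\mathcal{G}_{q,n,d}$ is the simple undirected graph with vertex set $\mathbb{F}_q^n$ in which two distinct vertices are adjacent if and only if their Hamming distance is less than $d$. The Lovász $\vartheta$-function of a finite simple graph $G$ is $\vartheta(G) = \min_{c,\{u_i\}} \max_{i\in V(G)} \frac{1}{(c^{T}u_i)^2}$, where the minimum is over all unit vectors $c$ and all orthonormal representations $\{u_i\}_{i\in V(G)}$ of $G$, i.e. assignments of unit real vectors $u_i$ to vertices such that $u_i^{T}u_j=0$ whenever $i\ne j$ are nonadjacent. Equivalently, with $N=|V(G)|$, it is the maximum of $\mathrm{Tr}(BJ)$ ($J$ the $N\times N$ all-ones matrix) over symmetric positive semidefinite $N\times N$ real matrices $B$ with $\mathrm{Tr}(B)=1$ and $B_{ij}=0$ for all adjacent $i,j$. Eigenvalues are ordered in non-increasing order, counted with multiplicity. *)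

theory Defs
  imports
    "HOL-Analysis.Analysis"
    "HOL-Computational_Algebra.Polynomial"
    "HOL-Library.Multiset"
begin

text \<open>
  A finite simple graph is given by its adjacency relation (symmetric and irreflexive) on a
  finite vertex type; every element of the type is a vertex.
\<close>

definition simple_graph :: "('v \<Rightarrow> 'v \<Rightarrow> bool) \<Rightarrow> bool" where
  "simple_graph E \<longleftrightarrow> symp E \<and> irreflp E"

definition regular_of_degree :: "('v::finite \<Rightarrow> 'v \<Rightarrow> bool) \<Rightarrow> nat \<Rightarrow> bool" where
  "regular_of_degree E k \<longleftrightarrow> (\<forall>x. card {y. E x y} = k)"

definition graph_compl :: "('v \<Rightarrow> 'v \<Rightarrow> bool) \<Rightarrow> 'v \<Rightarrow> 'v \<Rightarrow> bool" where
  "graph_compl E x y \<longleftrightarrow> x \<noteq> y \<and> \<not> E x y"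

lemma simple_graph_compl: "simple_graph E \<Longrightarrow> simple_graph (graph_compl E)"
  by (auto simp: simple_graph_def graph_compl_def symp_def irreflp_def)

definition hamming_dist :: "'a ^ 'n \<Rightarrow> 'a ^ 'n \<Rightarrow> nat" where
  "hamming_dist x y = card {i. x $ i \<noteq> y $ i}"

text \<open>The graph \<open>\<G>\<^sub>q\<^sub>,\<^sub>n\<^sub>,\<^sub>d\<close>, with \<open>q = CARD('a)\<close> and \<open>n = CARD('n)\<close>.\<close>

definition gen_hamming_graph ::
    "nat \<Rightarrow> ('a::{field,finite}) ^ 'n \<Rightarrow> 'a ^ 'n \<Rightarrow> bool" where
  "gen_hamming_graph d x y \<longleftrightarrow> x \<noteq> y \<and> hamming_dist x y < d"

lemma simple_gen_hamming_graph: "simple_graph (gen_hamming_graph d)"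
  by (auto simp: simple_graph_def gen_hamming_graph_def hamming_dist_def symp_def irreflp_def
      eq_commute)

definition adj_matrix :: "('v::finite \<Rightarrow> 'v \<Rightarrow> bool) \<Rightarrow> real ^ 'v ^ 'v" where
  "adj_matrix E = (\<chi> i j. if E i j then 1 else 0)"

definition charpoly :: "'a::comm_ring_1 ^ 'v ^ 'v \<Rightarrow> 'a poly" where
  "charpoly A = det (mat [:0, 1:] - map_matrix (\<lambda>a. [:a:]) A)"

text \<open>
  The real eigenvalues with multiplicity, in non-increasing order. For a symmetric matrix (such
  as an adjacency matrix) all roots of the characteristic polynomial are real, so the list has
  length \<open>CARD('v)\<close>.
\<close>

definition eigvals :: "real ^ 'v ^ 'v \<Rightarrow> real list" where
  "eigvals A = rev (sorted_list_of_multiset (proots (charpoly A)))"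

definition lambda_min :: "('v::finite \<Rightarrow> 'v \<Rightarrow> bool) \<Rightarrow> real" where
  "lambda_min E = last (eigvals (adj_matrix E))"

definition lambda2 :: "('v::finite \<Rightarrow> 'v \<Rightarrow> bool) \<Rightarrow> real" where
  "lambda2 E = eigvals (adj_matrix E) ! 1"

text \<open>
  The dimension of the vectors of an orthonormal representation is arbitrary and has to be
  quantified over, so vectors of \<open>\<real>\<^sup>m\<close> are functions on \<open>nat\<close> of which only the values
  below \<open>m\<close> matter.
\<close>

definition dot :: "nat \<Rightarrow> (nat \<Rightarrow> real) \<Rightarrow> (nat \<Rightarrow> real) \<Rightarrow> real" where
  "dot m x y = (\<Sum>l<m. x l * y l)"

definition orthonormal_rep ::
    "('v \<Rightarrow> 'v \<Rightarrow> bool) \<Rightarrow> nat \<Rightarrow> ('v \<Rightarrow> nat \<Rightarrow> real) \<Rightarrow> bool" where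
  "orthonormal_rep E m u \<longleftrightarrow>
     (\<forall>i. dot m (u i) (u i) = 1) \<and>
     (\<forall>i j. i \<noteq> j \<and> \<not> E i j \<longrightarrow> dot m (u i) (u j) = 0)"

text \<open>
  A pair \<open>(c, u)\<close> with \<open>c\<^sup>T u\<^sub>i = 0\<close> for some \<open>i\<close> has value \<open>1 / 0 = \<infinity>\<close> and never attains the
  minimum; it must be excluded explicitly because \<open>1 / 0 = 0\<close> in \<open>real\<close>.
\<close>

definition theta_values :: "('v::finite \<Rightarrow> 'v \<Rightarrow> bool) \<Rightarrow> real set" where
  "theta_values E =
     {Max (range (\<lambda>i. 1 / (dot m c (u i))\<^sup>2)) | m c u.
        dot m c c = 1 \<and> orthonormal_rep E m u \<and> (\<forall>i. dot m c (u i) \<noteq> 0)}"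

definition lovasz_theta :: "('v::finite \<Rightarrow> 'v \<Rightarrow> bool) \<Rightarrow> real" where
  "lovasz_theta E = (LEAST t. t \<in> theta_values E)"

end

theory Submission
  imports Defs "HOL-Combinatorics.Transposition"
begin

text \<open>
  If \<open>u\<close> and \<open>v\<close> are orthonormal representations of a graph on \<open>N\<close> vertices and of its complement,
  the vectors \<open>u\<^sub>i \<otimes> v\<^sub>i\<close> are orthonormal, so Bessel's inequality bounds the product of the two values
  below by \<open>N\<close>. Representations whose values multiply to \<open>N\<close> are therefore both optimal. For a
  \<open>k\<close>-regular graph with adjacency matrix \<open>A\<close> and smallest eigenvalue \<open>\<lambda>\<close>, the Gram matrix \<open>I - A / \<lambda>\<close>
  gives a representation of value \<open>N / (1 - k / \<lambda>)\<close>. If the automorphisms act transitively on the arcs,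
  averaging \<open>v v\<^sup>T\<close> for a \<open>\<lambda>\<close>-eigenvector \<open>v\<close> over the automorphism group gives, after scaling, a positive
  semidefinite \<open>P\<close> with diagonal \<open>1\<close>, entries \<open>\<lambda> / k\<close> on the edges and zero row sums, and, with \<open>J\<close> the all-ones matrix,
  \<open>(J - (k / \<lambda>) P) / (1 - k / \<lambda>)\<close> is a Gram matrix for the complement of value \<open>1 - k / \<lambda>\<close>.

  In case (1) the graph and in case (2) its complement is arc-transitive, and for regular graphs
  \<open>\<lambda>\<^sub>2\<close> of the graph is \<open>-1 - \<lambda>\<^sub>m\<^sub>i\<^sub>n\<close> of its complement.
\<close>

subsection \<open>Orthonormal representations and weak duality\<close>

definition psd_on :: "'v set \<Rightarrow> ('v \<Rightarrow> 'v \<Rightarrow> real) \<Rightarrow> bool" where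
  "psd_on S M \<longleftrightarrow> (\<forall>i\<in>S. \<forall>j\<in>S. M i j = M j i) \<and>
     (\<forall>x. 0 \<le> (\<Sum>i\<in>S. \<Sum>j\<in>S. M i j * x i * x j))"

lemma quad_form_insert:
  fixes M :: "'v \<Rightarrow> 'v \<Rightarrow> real"
  assumes "finite S" "a \<notin> S" "\<And>i. i \<in> S \<Longrightarrow> M i a = M a i"
  shows "(\<Sum>i\<in>insert a S. \<Sum>j\<in>insert a S. M i j * x i * x j) =
    M a a * (x a)\<^sup>2 + 2 * x a * (\<Sum>j\<in>S. M a j * x j) + (\<Sum>i\<in>S. \<Sum>j\<in>S. M i j * x i * x j)"
proof -
  have "(\<Sum>i\<in>S. M i a * x i * x a) = x a * (\<Sum>j\<in>S. M a j * x j)"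
    using assms(3) by (auto simp: sum_distrib_left algebra_simps intro!: sum.cong)
  moreover have "(\<Sum>j\<in>S. M a j * x a * x j) = x a * (\<Sum>j\<in>S. M a j * x j)"
    by (auto simp: sum_distrib_left algebra_simps intro!: sum.cong)
  ultimately show ?thesis
    using assms(1,2) by (simp add: sum.distrib power2_eq_square algebra_simps)
qed

text \<open>For \<open>j \<noteq> a\<close>, the form at the vector with entry \<open>t\<close> at
  \<open>a\<close> and \<open>1\<close> at \<open>j\<close> is \<open>2 * t * M a j + M j j\<close>.
  An affine function of \<open>t\<close> that is never negative has slope zero.\<close>

lemma psd_on_zero_diag:
  assumes psd: "psd_on S M" and S: "finite S" "a \<in> S" "j \<in> S" and zero: "M a a = 0"
  shows "M a j = 0"
proof (cases "j = a")
  case False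
  have sym: "M j a = M a j"
    using psd S unfolding psd_on_def by blast
  have nonneg: "0 \<le> 2 * t * M a j + M j j" for t
  proof -
    define x where "x i = (if i = a then t else if i = j then 1 else 0)" for i
    have "0 \<le> (\<Sum>i\<in>S. \<Sum>k\<in>S. M i k * x i * x k)"
      using psd unfolding psd_on_def by blast
    also have "\<dots> = (\<Sum>i\<in>{a,j}. \<Sum>k\<in>{a,j}. M i k * x i * x k)"
      using S by (intro sum.mono_neutral_cong_right ballI) (auto simp: x_def intro!: sum.mono_neutral_cong_right)
    also have "\<dots> = 2 * t * M a j + M j j"
      using False sym zero by (simp add: x_def algebra_simps)
    finally show ?thesis .
  qed
  show ?thesis
  proof (rule ccontr)
    assume "M a j \<noteq> 0"
    then show False
      using nonneg[of "- (M j j + 1) / (2 * M a j)"] by (simp add: field_simps)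
  qed
qed (use zero in simp)

lemma dot_Suc: "dot (Suc m) x y = dot m x y + x m * y m"
  by (simp add: dot_def)

lemma dot_cong: "(\<And>l. l < m \<Longrightarrow> x l = x' l) \<Longrightarrow> (\<And>l. l < m \<Longrightarrow> y l = y' l) \<Longrightarrow> dot m x y = dot m x' y'"
  by (auto simp: dot_def)

lemma dot_zero_left [simp]: "dot m (\<lambda>_. 0) y = 0"
  by (simp add: dot_def)

lemma dot_zero_right [simp]: "dot m y (\<lambda>_. 0) = 0"
  by (simp add: dot_def)

lemma dot_commute: "dot m x y = dot m y x"
  by (simp add: dot_def mult.commute)

text \<open>Cholesky factorization, by induction on the index set; this is why \<open>psd_on\<close>
  is relative to a set. If the pivot \<open>M a a\<close> vanishes, so does its row, and
  \<open>a\<close> gets the zero vector. Otherwise the Schur complement \<open>M'\<close> of the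
  pivot is factored on \<open>S\<close>, and one more coordinate restores the rank-one part that was
  subtracted.\<close>

lemma psd_on_gram:
  assumes "finite S" "psd_on S M"
  shows "\<exists>m u. \<forall>i\<in>S. \<forall>j\<in>S. M i j = dot m (u i) (u j)"
  using assms
proof (induction S arbitrary: M rule: finite_induct)
  case (insert a S)
  have sym: "M i j = M j i" if "i \<in> insert a S" "j \<in> insert a S" for i j
    using insert.prems that unfolding psd_on_def by blast
  have nonneg: "0 \<le> M a a * (x a)\<^sup>2 + 2 * x a * (\<Sum>j\<in>S. M a j * x j) +
      (\<Sum>i\<in>S. \<Sum>j\<in>S. M i j * x i * x j)" for x
  proof -
    have "0 \<le> (\<Sum>i\<in>insert a S. \<Sum>j\<in>insert a S. M i j * x i * x j)"
      using insert.prems unfolding psd_on_def by blast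
    also have "\<dots> = M a a * (x a)\<^sup>2 + 2 * x a * (\<Sum>j\<in>S. M a j * x j) +
      (\<Sum>i\<in>S. \<Sum>j\<in>S. M i j * x i * x j)"
      using insert.hyps sym by (intro quad_form_insert) auto
    finally show ?thesis .
  qed
  show ?case
  proof (cases "M a a = 0")
    case True
    have "0 \<le> (\<Sum>i\<in>S. \<Sum>j\<in>S. M i j * x i * x j)" for x
    proof -
      have "(\<Sum>i\<in>S. \<Sum>j\<in>S. M i j * (x(a := 0)) i * (x(a := 0)) j) = (\<Sum>i\<in>S. \<Sum>j\<in>S. M i j * x i * x j)"
        using insert.hyps(2) by (intro sum.cong) auto
      then show ?thesis
        using nonneg[of "x(a := 0)"] True by simp
    qed
    then have "psd_on S M"
      using sym by (auto simp: psd_on_def)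
    then obtain m u where u: "\<forall>i\<in>S. \<forall>j\<in>S. M i j = dot m (u i) (u j)"
      using insert.IH by blast
    have zero: "M a j = 0" "M j a = 0" if "j \<in> insert a S" for j
      using psd_on_zero_diag[OF insert.prems _ _ that True] insert.hyps sym[of j a] that by auto
    have "\<forall>i\<in>insert a S. \<forall>j\<in>insert a S. M i j = dot m ((u(a := \<lambda>_. 0)) i) ((u(a := \<lambda>_. 0)) j)"
      using u zero insert.hyps(2) by (auto simp del: fun_upd_apply simp add: fun_upd_def)
    then show ?thesis
      by blast
  next
    case False
    define M' where "M' i j = M i j - M a i * M a j / M a a" for i j
    have pos: "M a a > 0"
    proof -
      have "0 \<le> M a a"
        using nonneg[of "(\<lambda>_. 0)(a := 1)"] insert.hyps(2)
        by (simp add: sum.neutral)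
      then show ?thesis
        using False by simp
    qed
    have "0 \<le> (\<Sum>i\<in>S. \<Sum>j\<in>S. M' i j * x i * x j)" for x
    proof -
      define s where "s = (\<Sum>j\<in>S. M a j * x j)"
      \<comment> \<open>This entry minimizes the form as a quadratic in \<open>x a\<close>; the
        minimum is the form of the Schur complement.\<close>
      define y where "y = x(a := - s / M a a)"
      have y: "y i = x i" if "i \<in> S" for i
        using that insert.hyps by (auto simp: y_def)
      have "0 \<le> M a a * (y a)\<^sup>2 + 2 * y a * s + (\<Sum>i\<in>S. \<Sum>j\<in>S. M i j * x i * x j)"
        using nonneg[of y] y by (simp add: s_def)
      also have "\<dots> = (\<Sum>i\<in>S. \<Sum>j\<in>S. M i j * x i * x j) - s * s / M a a"
        using pos by (simp add: y_def power2_eq_square field_simps)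
      also have "s * s / M a a = (\<Sum>i\<in>S. \<Sum>j\<in>S. M a i * M a j / M a a * x i * x j)"
        unfolding s_def sum_product by (simp add: sum_divide_distrib algebra_simps)
      also have "(\<Sum>i\<in>S. \<Sum>j\<in>S. M i j * x i * x j) - \<dots> = (\<Sum>i\<in>S. \<Sum>j\<in>S. M' i j * x i * x j)"
        unfolding M'_def sum_subtractf[symmetric] by (simp add: algebra_simps)
      finally show ?thesis .
    qed
    then have "psd_on S M'"
      using sym by (auto simp: psd_on_def M'_def)
    then obtain m u where u: "\<forall>i\<in>S. \<forall>j\<in>S. M' i j = dot m (u i) (u j)"
      using insert.IH by blast
    \<comment> \<open>Coordinate \<open>m\<close> is the new one and contributes
      \<open>M a i * M a j / M a a\<close>; below \<open>m\<close> the vector of \<open>a\<close> is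
      zero. Values beyond \<open>m\<close> never enter \<open>dot (Suc m)\<close>.\<close>
    define w where "w i = (\<lambda>l. if l = m then M a i / sqrt (M a a) else if i = a then 0 else u i l)" for i
    have w: "dot (Suc m) (w i) (w j) = (if i = a \<or> j = a then 0 else dot m (u i) (u j)) + M a i * M a j / M a a" for i j
    proof -
      have "dot m (w i) (w j) = dot m (if i = a then (\<lambda>_. 0) else u i) (if j = a then (\<lambda>_. 0) else u j)"
        by (rule dot_cong) (auto simp: w_def)
      then show ?thesis
        using pos by (simp add: dot_Suc) (simp add: w_def)
    qed
    have "M i j = dot (Suc m) (w i) (w j)" if "i \<in> insert a S" "j \<in> insert a S" for i j
    proof (cases "i = a \<or> j = a")
      case True
      then show ?thesis
        unfolding w using that sym[of i j] pos by auto
    next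
      case False
      then have "M' i j = dot m (u i) (u j)"
        using that u by auto
      with False show ?thesis
        unfolding w M'_def by auto
    qed
    then show ?thesis
      by blast
  qed
qed simp

section \<open>Theta values from Gram matrices, and weak duality\<close>

lemma dot_sum_left: "dot m (\<lambda>l. \<Sum>i\<in>A. f i l) y = (\<Sum>i\<in>A. dot m (f i) y)"
  unfolding dot_def by (simp add: sum_distrib_right) (rule sum.swap)

lemma dot_scale_left: "dot m (\<lambda>l. a * x l) y = a * dot m x y"
  by (simp add: dot_def sum_distrib_left mult.assoc)

text \<open>The handle \<open>c\<close> is the normalized sum of the Gram vectors. That sum has
  squared length \<open>CARD('v) * r\<close>, and constant row sums give it the same inner product
  \<open>r\<close> with every vector, so the maximum runs over a constant.\<close>

lemma theta_value_of_gram: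
  fixes E :: "'v::finite \<Rightarrow> 'v \<Rightarrow> bool"
  assumes psd: "psd_on UNIV M" and diag: "\<And>i. M i i = 1"
    and nonadj: "\<And>i j. i \<noteq> j \<Longrightarrow> \<not> E i j \<Longrightarrow> M i j = 0"
    and row: "\<And>i. (\<Sum>j\<in>UNIV. M i j) = r" and r: "r > 0"
  shows "real CARD('v) / r \<in> theta_values E"
proof -
  let ?N = "real CARD('v)"
  obtain m u where u: "\<And>i j. M i j = dot m (u i) (u j)"
    using psd_on_gram[OF _ psd] by auto
  define c where "c = (\<lambda>l. 1 / sqrt (?N * r) * (\<Sum>i\<in>UNIV. u i l))"
  have cu: "dot m c (u j) = r / sqrt (?N * r)" for j
  proof -
    have "(\<Sum>i\<in>UNIV. M i j) = (\<Sum>i\<in>UNIV. M j i)"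
      using psd by (auto simp: psd_on_def)
    then show ?thesis
      unfolding c_def dot_scale_left dot_sum_left u[symmetric] by (simp add: row)
  qed
  have "dot m c c = 1 / sqrt (?N * r) * (\<Sum>i\<in>UNIV. dot m (u i) c)"
    by (subst (1) c_def) (simp only: dot_scale_left dot_sum_left)
  also have "\<dots> = 1 / sqrt (?N * r) * (\<Sum>i::'v\<in>UNIV. r / sqrt (?N * r))"
    by (simp only: cu dot_commute[of m _ c])
  also have "\<dots> = 1"
    using r by (simp add: field_simps)
  finally have c: "dot m c c = 1" .
  have "1 / (r / sqrt (?N * r))\<^sup>2 = ?N / r"
    using r by (simp add: power_divide) (simp add: power2_eq_square field_simps)
  then have "?N / r = Max (range (\<lambda>i. 1 / (dot m c (u i))\<^sup>2))"
    unfolding cu by simp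
  moreover have "orthonormal_rep E m u"
    using diag nonadj unfolding orthonormal_rep_def u by blast
  moreover have "\<forall>i. dot m c (u i) \<noteq> 0"
    using r by (simp add: cu)
  ultimately show ?thesis
    unfolding theta_values_def using c by blast
qed

text \<open>Distinct vertices are nonadjacent in one of the two graphs, so the tensors with
  coordinates \<open>u i l * v i p\<close> are orthonormal. \<open>w\<close> is the orthogonal
  projection of the unit tensor \<open>c l * d p\<close> onto their span, and the claim is that the
  squared length of the difference is nonnegative.\<close>

lemma orthonormal_rep_compl_bessel:
  fixes E :: "'v::finite \<Rightarrow> 'v \<Rightarrow> bool"
  assumes u: "orthonormal_rep E m u" and v: "orthonormal_rep (graph_compl E) k v"
    and c: "dot m c c = 1" and d: "dot k d d = 1"
  shows "(\<Sum>i\<in>UNIV. (dot m c (u i))\<^sup>2 * (dot k d (v i))\<^sup>2) \<le> 1"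
proof -
  define a where "a i = dot m c (u i) * dot k d (v i)" for i
  define w where "w l p = (\<Sum>i\<in>UNIV. a i * (u i l * v i p))" for l p
  have tensor: "(\<Sum>l<m. \<Sum>p<k. (x l * y p) * (x' l * y' p)) = dot m x x' * dot k y y'" for x x' y y'
    unfolding dot_def sum_product by (intro sum.cong) (auto simp: algebra_simps)
  have orth: "dot m (u i) (u j) * dot k (v i) (v j) = (if i = j then 1 else 0)" for i j
    using u v by (cases "E i j") (auto simp: orthonormal_rep_def graph_compl_def)
  have cw: "(\<Sum>l<m. \<Sum>p<k. (x l * y p) * w l p) = (\<Sum>i\<in>UNIV. a i * (dot m x (u i) * dot k y (v i)))" for x y
  proof -
    have "(\<Sum>l<m. \<Sum>p<k. (x l * y p) * w l p) = (\<Sum>l<m. \<Sum>p<k. \<Sum>i\<in>UNIV. a i * ((x l * y p) * (u i l * v i p)))"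
      by (simp add: w_def sum_distrib_left algebra_simps)
    also have "\<dots> = (\<Sum>l<m. \<Sum>i\<in>UNIV. \<Sum>p<k. a i * ((x l * y p) * (u i l * v i p)))"
      by (intro sum.cong refl sum.swap)
    also have "\<dots> = (\<Sum>i\<in>UNIV. \<Sum>l<m. \<Sum>p<k. a i * ((x l * y p) * (u i l * v i p)))"
      by (rule sum.swap)
    also have "\<dots> = (\<Sum>i\<in>UNIV. a i * (\<Sum>l<m. \<Sum>p<k. (x l * y p) * (u i l * v i p)))"
      by (simp add: sum_distrib_left)
    finally show ?thesis
      by (simp add: tensor)
  qed
  have "(\<Sum>l<m. \<Sum>p<k. w l p * w l p) = (\<Sum>l<m. \<Sum>p<k. \<Sum>i\<in>UNIV. a i * ((u i l * v i p) * w l p))"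
    by (intro sum.cong refl) (simp add: w_def[of _ _] sum_distrib_right algebra_simps)
  also have "\<dots> = (\<Sum>l<m. \<Sum>i\<in>UNIV. \<Sum>p<k. a i * ((u i l * v i p) * w l p))"
    by (intro sum.cong refl sum.swap)
  also have "\<dots> = (\<Sum>i\<in>UNIV. \<Sum>l<m. \<Sum>p<k. a i * ((u i l * v i p) * w l p))"
    by (rule sum.swap)
  also have "\<dots> = (\<Sum>i\<in>UNIV. a i * (\<Sum>l<m. \<Sum>p<k. (u i l * v i p) * w l p))"
    by (simp add: sum_distrib_left)
  also have "\<dots> = (\<Sum>i\<in>UNIV. (a i)\<^sup>2)"
    unfolding cw orth by (simp add: power2_eq_square if_distrib cong: if_cong)
  finally have ww: "(\<Sum>l<m. \<Sum>p<k. w l p * w l p) = (\<Sum>i\<in>UNIV. (a i)\<^sup>2)" .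
  have "0 \<le> (\<Sum>l<m. \<Sum>p<k. (c l * d p - w l p)\<^sup>2)"
    by (intro sum_nonneg) auto
  also have "\<dots> = (\<Sum>l<m. \<Sum>p<k. (c l * d p) * (c l * d p)) - 2 * (\<Sum>l<m. \<Sum>p<k. (c l * d p) * w l p)
      + (\<Sum>l<m. \<Sum>p<k. w l p * w l p)"
    by (simp add: power2_eq_square sum_distrib_left sum.distrib[symmetric] sum_subtractf[symmetric] algebra_simps)
  also have "\<dots> = 1 - (\<Sum>i\<in>UNIV. (a i)\<^sup>2)"
    unfolding ww cw tensor c d by (simp add: a_def power2_eq_square)
  finally show ?thesis
    by (simp add: a_def power_mult_distrib)
qed

lemma theta_valuesE:
  fixes E :: "'v::finite \<Rightarrow> 'v \<Rightarrow> bool"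
  assumes "t \<in> theta_values E"
  obtains m c u where "dot m c c = 1" "orthonormal_rep E m u" "t > 0"
    "\<And>i. 1 / t \<le> (dot m c (u i))\<^sup>2"
proof -
  obtain m c u where t: "t = Max (range (\<lambda>i. 1 / (dot m c (u i))\<^sup>2))" and c: "dot m c c = 1"
    and u: "orthonormal_rep E m u" and nz: "\<And>i. dot m c (u i) \<noteq> 0"
    using assms unfolding theta_values_def by blast
  have le: "1 / (dot m c (u i))\<^sup>2 \<le> t" for i
    unfolding t by (intro Max_ge) auto
  moreover have pos: "0 < 1 / (dot m c (u i))\<^sup>2" for i
    using nz by simp
  ultimately have "t > 0"
    by (meson less_le_trans)
  moreover have "1 / t \<le> (dot m c (u i))\<^sup>2" for i
    using le[of i] nz[of i] \<open>t > 0\<close> by (simp add: field_simps)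
  ultimately show ?thesis
    using that c u by blast
qed

lemma theta_values_weak_duality:
  fixes E :: "'v::finite \<Rightarrow> 'v \<Rightarrow> bool"
  assumes t: "t \<in> theta_values E" and s: "s \<in> theta_values (graph_compl E)"
  shows "t > 0" "s > 0" "real CARD('v) \<le> t * s"
proof -
  obtain m c u where u: "dot m c c = 1" "orthonormal_rep E m u" "t > 0"
    "\<And>i. 1 / t \<le> (dot m c (u i))\<^sup>2"
    using theta_valuesE[OF t] by metis
  obtain k d v where v: "dot k d d = 1" "orthonormal_rep (graph_compl E) k v" "s > 0"
    "\<And>i. 1 / s \<le> (dot k d (v i))\<^sup>2"
    using theta_valuesE[OF s] by metis
  have "real CARD('v) * (1 / t * (1 / s)) = (\<Sum>i::'v\<in>UNIV. 1 / t * (1 / s))"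
    by simp
  also have "\<dots> \<le> (\<Sum>i\<in>UNIV. (dot m c (u i))\<^sup>2 * (dot k d (v i))\<^sup>2)"
    using u(3,4) v(3,4) by (intro sum_mono mult_mono) auto
  also have "\<dots> \<le> 1"
    by (rule orthonormal_rep_compl_bessel) fact+
  finally show "real CARD('v) \<le> t * s"
    using u(3) v(3) by (simp add: field_simps)
  show "t > 0" "s > 0"
    by fact+
qed

text \<open>Each value bounds the other set from below by weak duality. As both values belong to
  their sets, both minima are attained, which gives the two \<open>LEAST\<close> terms a
  meaning.\<close>

lemma lovasz_theta_eqI:
  fixes E :: "'v::finite \<Rightarrow> 'v \<Rightarrow> bool"
  assumes t: "t \<in> theta_values E" and s: "s \<in> theta_values (graph_compl E)"
    and ts: "t * s = real CARD('v)"
  shows "lovasz_theta E = t" "lovasz_theta (graph_compl E) = s"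
proof -
  note pos = theta_values_weak_duality(1,2)[OF t s]
  show "lovasz_theta E = t"
    unfolding lovasz_theta_def
  proof (rule Least_equality, rule t)
    fix t' assume "t' \<in> theta_values E"
    from theta_values_weak_duality(3)[OF this s] show "t \<le> t'"
      using pos by (simp flip: ts)
  qed
  show "lovasz_theta (graph_compl E) = s"
    unfolding lovasz_theta_def
  proof (rule Least_equality, rule s)
    fix s' assume "s' \<in> theta_values (graph_compl E)"
    from theta_values_weak_duality(3)[OF t this] show "s \<le> s'"
      using pos by (simp flip: ts)
  qed
qed

subsection \<open>Eigenvalues and characteristic polynomials\<close>

text \<open>By compactness the Rayleigh quotient has a minimizer \<open>v\<close> on the unit
  sphere. Moving from \<open>v\<close> along the residual \<open>w\<close> changes the form,
  relative to \<open>l\<close>, by \<open>2 * t * (w \<bullet> w)\<close> to first order, so a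
  nonzero residual would allow values below the minimum.\<close>

lemma symmetric_min_eigenvector:
  fixes A :: "real ^ 'v ^ 'v"
  assumes sym: "transpose A = A"
  obtains l v where "v \<noteq> 0" "A *v v = l *\<^sub>R v" "\<And>x. l * (x \<bullet> x) \<le> x \<bullet> (A *v x)"
proof -
  have adj: "x \<bullet> (A *v y) = (A *v x) \<bullet> y" for x y
    by (metis dot_lmul_matrix sym vector_transpose_matrix)
  obtain e :: "real ^ 'v" where "norm e = 1"
    using vector_choose_size[of 1] by auto
  then have "sphere (0 :: real ^ 'v) 1 \<noteq> {}"
    by auto
  moreover have "continuous_on (sphere 0 1) (\<lambda>x. x \<bullet> (A *v x))"
    by (intro continuous_intros matrix_vector_mult_linear_continuous_on)
  ultimately obtain v where v: "norm v = 1" and min: "\<And>y. norm y = 1 \<Longrightarrow> v \<bullet> (A *v v) \<le> y \<bullet> (A *v y)"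
    using continuous_attains_inf[of "sphere 0 1" "\<lambda>x. x \<bullet> (A *v x)"] by (auto simp: compact_sphere)
  define l where "l = v \<bullet> (A *v v)"
  have lower: "l * (x \<bullet> x) \<le> x \<bullet> (A *v x)" for x
  proof (cases "x = 0")
    case False
    have "l \<le> (x /\<^sub>R norm x) \<bullet> (A *v (x /\<^sub>R norm x))"
      unfolding l_def using False by (intro min) simp
    also have "\<dots> = (x \<bullet> (A *v x)) / (norm x)\<^sup>2"
      by (simp add: matrix_vector_mult_scaleR power2_eq_square divide_inverse algebra_simps)
    finally show ?thesis
      using False by (simp add: field_simps power2_norm_eq_inner)
  qed simp
  define w where "w = A *v v - l *\<^sub>R v"
  have quad: "0 \<le> 2 * t * (w \<bullet> w) + t\<^sup>2 * (w \<bullet> (A *v w) - l * (w \<bullet> w))" for t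
  proof -
    have "(v + t *\<^sub>R w) \<bullet> (A *v (v + t *\<^sub>R w)) - l * ((v + t *\<^sub>R w) \<bullet> (v + t *\<^sub>R w)) =
        (v \<bullet> (A *v v) - l * (v \<bullet> v)) + 2 * t * (w \<bullet> (A *v v) - l * (w \<bullet> v)) +
        t\<^sup>2 * (w \<bullet> (A *v w) - l * (w \<bullet> w))"
      using adj[of v w]
      by (simp add: matrix_vector_right_distrib matrix_vector_mult_scaleR inner_add_left inner_add_right
          inner_commute[of v w] inner_commute[of "A *v v" w] power2_eq_square algebra_simps)
    also have "v \<bullet> (A *v v) - l * (v \<bullet> v) = 0"
      using v by (simp add: l_def norm_eq_1)
    also have "w \<bullet> (A *v v) - l * (w \<bullet> v) = w \<bullet> w"
      by (simp add: w_def inner_diff_right)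
    finally show ?thesis
      using lower[of "v + t *\<^sub>R w"] by simp
  qed
  have "w \<bullet> w = 0"
  proof (rule ccontr)
    assume "w \<bullet> w \<noteq> 0"
    then have pos: "w \<bullet> w > 0"
      by simp
    define b where "b = w \<bullet> (A *v w) - l * (w \<bullet> w)"
    \<comment> \<open>Negative and small enough for the linear term to outweigh the quadratic one;
      \<open>b + 1\<close> keeps the denominator positive when \<open>b = 0\<close>.\<close>
    define t where "t = - (w \<bullet> w) / (b + 1)"
    have b: "b \<ge> 0"
      using lower[of w] by (simp add: b_def)
    have "2 * t * (w \<bullet> w) + t\<^sup>2 * b = - (w \<bullet> w)\<^sup>2 * (b + 2) / (b + 1)\<^sup>2"
      using b by (simp add: t_def power2_eq_square divide_simps) (simp add: algebra_simps)
    also have "\<dots> < 0"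
      using b pos by (simp add: divide_neg_pos mult_neg_pos)
    finally show False
      using quad[of t] by (simp add: b_def)
  qed
  then have "A *v v = l *\<^sub>R v"
    by (simp add: w_def)
  moreover have "v \<noteq> 0"
    using v by auto
  ultimately show ?thesis
    using that lower by blast
qed

section \<open>Characteristic polynomials and their real roots\<close>

lemma poly_det: "poly (det P) x = det (map_matrix (\<lambda>p. poly p x) P)"
proof -
  have "poly (of_int (sign p)) x = of_int (sign p)" for p :: "'a \<Rightarrow> 'a"
    by (simp add: sign_def)
  then show ?thesis
    by (simp add: det_def poly_sum poly_prod)
qed

lemma poly_charpoly: "poly (charpoly A) x = det (mat x - A)"
  unfolding charpoly_def poly_det
  by (intro arg_cong[of _ _ det]) (simp add: vec_eq_iff mat_def)

lemma poly_charpoly_eq_0_iff: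
  fixes A :: "real ^ 'v ^ 'v"
  shows "poly (charpoly A) x = 0 \<longleftrightarrow> (\<exists>v. v \<noteq> 0 \<and> A *v v = x *\<^sub>R v)"
proof -
  have "(mat x - A) *v v = x *\<^sub>R v - A *v v" for v
  proof -
    have "mat x *v v = x *\<^sub>R v"
      by (simp add: vec_eq_iff matrix_vector_mult_def mat_def if_distrib if_distribR cong: if_cong)
    then show ?thesis
      by (simp add: matrix_vector_mult_diff_rdistrib)
  qed
  then have "(mat x - A) *v v = 0 \<longleftrightarrow> A *v v = x *\<^sub>R v" for v
    by auto
  moreover have "poly (charpoly A) x \<noteq> 0 \<longleftrightarrow> (\<forall>v. (mat x - A) *v v = 0 \<longrightarrow> v = 0)"
    unfolding poly_charpoly invertible_det_nz[symmetric] invertible_left_inverse matrix_left_invertible_ker ..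
  ultimately show ?thesis
    by auto
qed

text \<open>No eigenvalue lies below the Rayleigh minimum \<open>l\<close>, so \<open>l - 1\<close>
  is not a root. \<open>set_count_proots\<close> and \<open>proots_mult\<close> are applied later
  under this condition.\<close>

lemma charpoly_nonzero:
  fixes A :: "real ^ 'v ^ 'v"
  assumes "transpose A = A"
  shows "charpoly A \<noteq> 0"
proof
  obtain l where l: "\<And>x. l * (x \<bullet> x) \<le> x \<bullet> (A *v x)"
    using symmetric_min_eigenvector[OF assms] by metis
  assume "charpoly A = 0"
  then have "poly (charpoly A) (l - 1) = 0"
    by simp
  then obtain v where v: "v \<noteq> 0" "A *v v = (l - 1) *\<^sub>R v"
    unfolding poly_charpoly_eq_0_iff by blast
  then have "v \<bullet> v > 0" "l * (v \<bullet> v) \<le> (l - 1) * (v \<bullet> v)"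
    using l[of v] by simp_all
  then show False
    by (simp only: mult_le_cancel_right) simp
qed

lemma set_proots_charpoly:
  fixes A :: "real ^ 'v ^ 'v"
  assumes "transpose A = A"
  shows "set_mset (proots (charpoly A)) = {x. \<exists>v. v \<noteq> 0 \<and> A *v v = x *\<^sub>R v}"
  by (simp add: set_count_proots[OF charpoly_nonzero[OF assms]] poly_charpoly_eq_0_iff)

lemma eigenvalue_ge:
  fixes A :: "real ^ 'v ^ 'v"
  assumes "\<And>x. l * (x \<bullet> x) \<le> x \<bullet> (A *v x)" "v \<noteq> 0" "A *v v = x *\<^sub>R v"
  shows "l \<le> x"
  using assms(1)[of v] assms(2,3) by simp

lemma transpose_adj_matrix:
  assumes "simple_graph E"
  shows "transpose (adj_matrix E) = adj_matrix E"
  using assms by (auto simp: vec_eq_iff adj_matrix_def transpose_def simple_graph_def symp_def)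

text \<open>Connects \<open>lambda_min\<close>, read off the list of roots, with the Rayleigh
  minimum: the latter is an eigenvalue, and no eigenvalue is smaller.\<close>

lemma lambda_min_eigenvector:
  fixes E :: "'v::finite \<Rightarrow> 'v \<Rightarrow> bool"
  assumes "simple_graph E"
  obtains v where "v \<noteq> 0" "adj_matrix E *v v = lambda_min E *\<^sub>R v"
    "\<And>x. lambda_min E * (x \<bullet> x) \<le> x \<bullet> (adj_matrix E *v x)"
proof -
  let ?A = "adj_matrix E"
  note sym = transpose_adj_matrix[OF assms]
  obtain l v where l: "v \<noteq> 0" "?A *v v = l *\<^sub>R v" "\<And>x. l * (x \<bullet> x) \<le> x \<bullet> (?A *v x)"
    using symmetric_min_eigenvector[OF sym] by metis
  let ?xs = "sorted_list_of_multiset (proots (charpoly ?A))"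
  have set: "set ?xs = {x. \<exists>v. v \<noteq> 0 \<and> ?A *v v = x *\<^sub>R v}"
    by (simp add: set_proots_charpoly[OF sym])
  have "l \<in> set ?xs" and le: "\<forall>x\<in>set ?xs. l \<le> x"
    unfolding set using l eigenvalue_ge[OF l(3)] by blast+
  then have ne: "?xs \<noteq> []"
    by force
  then have "hd ?xs \<le> l"
    using \<open>l \<in> set ?xs\<close> sorted_sorted_list_of_multiset[of "proots (charpoly ?A)"]
    by (cases ?xs) auto
  then have "hd ?xs = l"
    using le hd_in_set[OF ne] by fastforce
  then have "lambda_min E = l"
    using ne by (simp add: lambda_min_def eigvals_def last_rev)
  with l that show ?thesis
    by metis
qed

section \<open>A rank-one determinant and the shift of one eigenvalue\<close>

lemma det_unit_rows_except_one:
  fixes A :: "'a::field ^ 'n ^ 'n"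
  assumes "\<And>i. i \<noteq> a \<Longrightarrow> A $ i = axis i 1"
  shows "det A = A $ a $ a"
proof -
  have "det A = (\<Prod>i\<in>UNIV. A $ i $ i)"
  proof -
    \<comment> \<open>Subtracting \<open>A $ a $ i\<close> times the unit row \<open>i\<close> for
      every \<open>i \<noteq> a\<close> clears row \<open>a\<close> off the diagonal.\<close>
    define B where "B = (\<chi> k. if k = a then row a A + (\<Sum>i\<in>-{a}. (- A $ a $ i) *s row i A) else row k A)"
    have "det B = det A"
      unfolding B_def by (intro det_row_span vec.span_sum vec.span_scale vec.span_base) auto
    moreover have B: "B $ i $ j = (if i = j then A $ i $ i else 0)" for i j
    proof (cases "i = a")
      case True
      have "(\<Sum>i\<in>-{a}. A $ a $ i * A $ i $ j) = (\<Sum>i\<in>-{a}. if i = j then A $ a $ j else 0)"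
        using assms by (intro sum.cong) (auto simp: axis_def)
      then show ?thesis
        using True assms[of j] by (auto simp: B_def row_def sum_negf sum.delta)
    next
      case False
      then show ?thesis
        using assms[of i] by (auto simp: B_def row_def axis_def)
    qed
    moreover have "det B = (\<Prod>i\<in>UNIV. B $ i $ i)"
      by (rule det_diagonal) (simp add: B)
    ultimately show ?thesis
      by (simp add: B)
  qed
  also have "\<dots> = (\<Prod>i\<in>UNIV. if i = a then A $ a $ a else 1)"
    using assms by (intro prod.cong) (auto simp: axis_def)
  finally show ?thesis
    by simp
qed

text \<open>\<open>M S\<close> has the constant row added only in the rows of \<open>S\<close>. By
  linearity in row \<open>a\<close>, enlarging \<open>S\<close> by \<open>a\<close> adds
  \<open>s\<close> times a determinant whose row \<open>a\<close> is all ones; there, multiples of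
  row \<open>a\<close> can be removed from the other rows, which leaves the value
  \<open>1\<close>.\<close>

lemma det_identity_plus_const:
  fixes s :: "'a::field"
  shows "det (mat 1 + (\<chi> i j. s) :: 'a ^ 'n ^ 'n) = 1 + s * of_nat CARD('n)"
proof -
  define M :: "'n set \<Rightarrow> 'a ^ 'n ^ 'n" where "M S = (\<chi> i. axis i 1 + (if i \<in> S then (\<chi> j. s) else 0))" for S
  have "det (M S) = 1 + s * of_nat (card S)" for S
  proof (induction S rule: finite_induct[OF finite])
    case 1
    have "M {} = mat 1"
      by (auto simp: M_def vec_eq_iff mat_def axis_def)
    then show ?case
      by simp
  next
    case (2 a S)
    have "M (insert a S) = (\<chi> i. if i = a then axis a 1 + s *s (\<chi> j. 1) else M S $ i)"
      using 2 by (auto simp: M_def vec_eq_iff)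
    then have "det (M (insert a S)) = det (\<chi> i. if i = a then axis a 1 else M S $ i)
        + s * det (\<chi> i. if i = a then (\<chi> j. 1) else M S $ i)"
      by (simp only: det_row_add det_row_mul)
    also have "(\<chi> i. if i = a then axis a 1 else M S $ i) = M S"
      using 2 by (auto simp: M_def vec_eq_iff)
    also have "det (\<chi> i. if i = a then (\<chi> j. 1) else M S $ i) = 1"
    proof -
      define D :: "'n set \<Rightarrow> 'a ^ 'n ^ 'n" where "D T = (\<chi> i. if i = a then (\<chi> j. 1) else M T $ i)" for T
      have "det (D T) = 1" if "a \<notin> T" for T
        using finite[of T] that
      proof (induction T rule: finite_induct)
        case empty
        have "det (D {}) = D {} $ a $ a"
          by (rule det_unit_rows_except_one) (auto simp: D_def M_def vec_eq_iff)
        then show ?case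
          by (simp add: D_def)
      next
        case (insert b T)
        have "D (insert b T) = (\<chi> k. if k = b then row b (D T) + s *s row a (D T) else row k (D T))"
          using insert by (auto simp: D_def M_def vec_eq_iff row_def)
        then show ?case
          using insert det_row_operation[of b a "D T" s] by auto
      qed
      then show ?thesis
        using 2 by (simp add: D_def)
    qed
    finally show ?case
      using 2 by (simp add: algebra_simps)
  qed
  moreover have "M UNIV = mat 1 + (\<chi> i j. s)"
    by (auto simp: M_def vec_eq_iff mat_def axis_def)
  ultimately show ?thesis
    by metis
qed

text \<open>
  For \<open>x \<noteq> k\<close> the matrix \<open>xI - A\<close> times \<open>I + J / (x - k)\<close> is \<open>xI - (A - J)\<close>. So passing to \<open>A - J\<close>
  moves one eigenvalue from \<open>k\<close> to \<open>k - N\<close> and keeps the others with their multiplicities.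
\<close>

lemma charpoly_minus_ones:
  fixes A :: "real ^ 'v ^ 'v"
  assumes row: "\<And>i. (\<Sum>j\<in>UNIV. A $ i $ j) = k"
  shows "charpoly A * [:- (k - real CARD('v)), 1:] = [:- k, 1:] * charpoly (A - (\<chi> i j. 1))"
proof -
  let ?N = "real CARD('v)"
  let ?p = "charpoly A * [:- (k - ?N), 1:] - [:- k, 1:] * charpoly (A - (\<chi> i j. 1))"
  \<comment> \<open>The extra factor vanishes at the excluded point \<open>x = k\<close>, so the
    identity holds everywhere; the factor is then cancelled in the ring of polynomials.\<close>
  have "poly ([:- k, 1:] * ?p) x = 0" for x
  proof (cases "x = k")
    case False
    define s where "s = 1 / (x - k)"
    have "(mat x - A) ** (mat 1 + (\<chi> i j. s)) = mat x - (A - (\<chi> i j. 1))"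
    proof -
      have "(\<Sum>l\<in>UNIV. (mat x - A) $ i $ l) * s = 1" for i
        using False by (simp add: s_def row sum_subtractf mat_def sum.delta)
      then have "(mat x - A) ** (\<chi> i j. s) = (\<chi> i j. 1)"
        by (simp add: vec_eq_iff matrix_matrix_mult_def sum_distrib_right)
      then show ?thesis
        by (simp add: matrix_add_ldistrib)
    qed
    then have "det (mat x - A) * (1 + s * ?N) = det (mat x - (A - (\<chi> i j. 1)))"
      by (metis det_identity_plus_const det_mul)
    then have "poly (charpoly A) x * (1 + s * ?N) = poly (charpoly (A - (\<chi> i j. 1))) x"
      by (simp only: poly_charpoly)
    moreover have "(x - k) * (1 + s * ?N) = x - k + ?N"
      using False by (simp add: s_def field_simps)
    ultimately have "poly (charpoly A) x * (x - k + ?N) = (x - k) * poly (charpoly (A - (\<chi> i j. 1))) x"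
      by (metis mult.assoc mult.commute)
    then have "poly ?p x = 0"
      by (simp add: algebra_simps)
    then show ?thesis
      by (simp only: poly_mult mult_zero_right)
  qed simp
  then have "[:- k, 1:] * ?p = 0"
    unfolding poly_all_0_iff_0[symmetric] by blast
  then show ?thesis
    by (simp only: mult_eq_0_iff) auto
qed

subsection \<open>Regular and arc-transitive graphs\<close>

lemma graph_compl_compl:
  assumes "simple_graph E"
  shows "graph_compl (graph_compl E) = E"
  using assms by (auto simp: fun_eq_iff graph_compl_def simple_graph_def irreflp_def)

lemma adj_matrix_mult_vec: "(adj_matrix E *v x) $ i = (\<Sum>j | E i j. x $ j)"
  by (simp add: adj_matrix_def matrix_vector_mult_def if_distrib if_distribR sum.If_cases cong: if_cong)

lemma adj_matrix_mult_ones: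
  assumes "regular_of_degree E k"
  shows "adj_matrix E *v 1 = real k *\<^sub>R 1"
  using assms by (simp add: vec_eq_iff adj_matrix_mult_vec regular_of_degree_def)

text \<open>Eigenvectors of a symmetric matrix for different eigenvalues are orthogonal, and the
  all-ones vector has eigenvalue \<open>k\<close>.\<close>

lemma regular_eigenvector_sum:
  fixes E :: "'v::finite \<Rightarrow> 'v \<Rightarrow> bool"
  assumes "simple_graph E" "regular_of_degree E k" "adj_matrix E *v x = l *\<^sub>R x" "l \<noteq> real k"
  shows "(\<Sum>i\<in>UNIV. x $ i) = 0"
proof -
  have "real k * (1 \<bullet> x) = (adj_matrix E *v 1) \<bullet> x"
    by (simp add: adj_matrix_mult_ones[OF assms(2)])
  also have "\<dots> = 1 \<bullet> (adj_matrix E *v x)"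
    by (metis dot_lmul_matrix transpose_adj_matrix[OF assms(1)] vector_transpose_matrix)
  also have "\<dots> = l * (1 \<bullet> x)"
    by (simp add: assms(3))
  finally have "1 \<bullet> x = 0"
    using assms(4) by simp
  then show ?thesis
    by (simp add: inner_vec_def)
qed

text \<open>At a coordinate of largest absolute value, the eigenvalue equation equates
  \<open>l * x $ i\<close> with a sum of \<open>k\<close> entries that are no larger in absolute
  value.\<close>

lemma regular_eigenvalue_le:
  fixes E :: "'v::finite \<Rightarrow> 'v \<Rightarrow> bool"
  assumes "regular_of_degree E k" "x \<noteq> 0" "adj_matrix E *v x = l *\<^sub>R x"
  shows "l \<le> real k"
proof -
  obtain i where i: "\<And>j. \<bar>x $ j\<bar> \<le> \<bar>x $ i\<bar>"
  proof -
    have "Max (range (\<lambda>j. \<bar>x $ j\<bar>)) \<in> range (\<lambda>j. \<bar>x $ j\<bar>)"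
      by (intro Max_in) auto
    then obtain i where "Max (range (\<lambda>j. \<bar>x $ j\<bar>)) = \<bar>x $ i\<bar>"
      by (rule imageE)
    moreover have "\<bar>x $ j\<bar> \<le> Max (range (\<lambda>j. \<bar>x $ j\<bar>))" for j
      by (intro Max_ge) auto
    ultimately show ?thesis
      using that by metis
  qed
  have pos: "\<bar>x $ i\<bar> > 0"
  proof (rule ccontr)
    assume "\<not> ?thesis"
    then have "x $ j = 0" for j
      using i[of j] by simp
    then show False
      using assms(2) by (simp add: vec_eq_iff)
  qed
  have "l * \<bar>x $ i\<bar> \<le> \<bar>l * x $ i\<bar>"
    by (simp add: abs_mult mult_right_mono)
  also have "l * x $ i = (\<Sum>j | E i j. x $ j)"
    using arg_cong[OF assms(3), of "\<lambda>v. v $ i"] by (simp add: adj_matrix_mult_vec)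
  also have "\<bar>\<Sum>j | E i j. x $ j\<bar> \<le> (\<Sum>j | E i j. \<bar>x $ i\<bar>)"
    by (rule order_trans[OF sum_abs]) (intro sum_mono i)
  also have "\<dots> = real k * \<bar>x $ i\<bar>"
    using assms(1) by (simp add: regular_of_degree_def)
  finally show ?thesis
    using pos by simp
qed

text \<open>The difference of the unit vectors at the ends of an edge has Rayleigh quotient
  \<open>-1\<close>.\<close>

lemma lambda_min_le_minus_one:
  fixes E :: "'v::finite \<Rightarrow> 'v \<Rightarrow> bool"
  assumes E: "simple_graph E" and ab: "E a b"
  shows "lambda_min E \<le> - 1"
proof -
  have ne: "a \<noteq> b" and ba: "E b a" and irr: "\<not> E a a" "\<not> E b b"
    using assms by (auto simp: simple_graph_def symp_def irreflp_def)
  define x :: "real ^ 'v" where "x = axis a 1 - axis b 1"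
  obtain v where low: "\<And>x. lambda_min E * (x \<bullet> x) \<le> x \<bullet> (adj_matrix E *v x)"
    using lambda_min_eigenvector[OF E] by metis
  have "x \<bullet> x = 2"
    using ne by (simp add: x_def inner_diff_left inner_diff_right inner_axis_axis)
  moreover have "x \<bullet> (adj_matrix E *v x) = - 2"
    using ne ab ba irr
    by (simp add: x_def inner_diff_left inner_diff_right matrix_vector_mult_diff_distrib
        matrix_vector_mul_component inner_axis' matrix_vector_mult_basis column_def adj_matrix_def)
  ultimately show ?thesis
    using low[of x] by simp
qed

lemma regular_of_degree_compl:
  fixes E :: "'v::finite \<Rightarrow> 'v \<Rightarrow> bool"
  assumes "simple_graph E" "regular_of_degree E k"
  shows "regular_of_degree (graph_compl E) (CARD('v) - 1 - k)" "k < CARD('v)"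
proof -
  have irr: "\<not> E x x" for x
    using assms by (auto simp: simple_graph_def irreflp_def)
  have "card {y. graph_compl E x y} = CARD('v) - 1 - k \<and> k < CARD('v)" for x
  proof -
    have "{y. graph_compl E x y} = - insert x {y. E x y}"
      by (auto simp: graph_compl_def)
    moreover have "card (insert x {y. E x y}) = Suc k"
      using assms(2) irr by (simp add: regular_of_degree_def)
    moreover have "card (insert x {y. E x y}) \<le> CARD('v)"
      by (intro card_mono) auto
    ultimately show ?thesis
      by (simp add: Compl_eq_Diff_UNIV card_Diff_subset)
  qed
  then show "regular_of_degree (graph_compl E) (CARD('v) - 1 - k)" "k < CARD('v)"
    by (auto simp: regular_of_degree_def)
qed

text \<open>Only one copy of \<open>k\<close> is split off, so \<open>m = k\<close> is allowed;
  multiplicity then makes the second entry equal to the first.\<close>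

lemma eigvals_nth_1:
  assumes proots: "proots (charpoly A) = add_mset k R" and k: "\<And>x. x \<in># R \<Longrightarrow> x \<le> k"
    and m: "m \<in># R" "\<And>x. x \<in># R \<Longrightarrow> x \<le> m"
  shows "eigvals A ! 1 = m"
proof -
  let ?xs = "sorted_list_of_multiset R"
  have "List.insort k ?xs = ?xs @ [k]"
    using k by (intro sorted_insort_is_snoc) auto
  then have eig: "eigvals A = k # rev ?xs"
    by (simp add: eigvals_def proots)
  have ne: "?xs \<noteq> []"
    using m(1) by (metis empty_iff list.set(1) set_sorted_list_of_multiset)
  have "last ?xs \<le> m"
    using m(2) last_in_set[OF ne] by simp
  moreover have "m \<le> last ?xs"
  proof -
    have "m \<in> set ?xs"
      using m(1) by simp
    moreover have "sorted (butlast ?xs @ [last ?xs])"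
      using ne by simp
    ultimately show ?thesis
      by (metis append_butlast_last_id ne sorted_append list.set_intros(1) order_refl
          Un_iff set_append empty_iff list.set(1) set_ConsD)
  qed
  ultimately show ?thesis
    using ne by (simp add: eig hd_conv_nth[symmetric] hd_rev)
qed

text \<open>Since \<open>A - J = - I - C\<close> for the adjacency matrix \<open>C\<close> of the
  complement, the largest eigenvalue of \<open>A - J\<close> is \<open>?\<mu>\<close>. By
  \<open>charpoly_minus_ones\<close> the roots for \<open>A\<close> arise from those for
  \<open>A - J\<close> by replacing one copy of \<open>k - N\<close> by \<open>k\<close>, which is
  the top eigenvalue; the second largest is thus the largest of the rest.\<close>

lemma lambda2_eq:
  fixes E :: "'v::finite \<Rightarrow> 'v \<Rightarrow> bool"
  assumes E: "simple_graph E" and reg: "regular_of_degree E k" and nonadj: "graph_compl E a b"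
  shows "lambda2 E = - 1 - lambda_min (graph_compl E)"
proof -
  let ?A = "adj_matrix E" and ?C = "adj_matrix (graph_compl E)" and ?J = "(\<chi> i j. 1) :: real ^ 'v ^ 'v"
  let ?N = "real CARD('v)" and ?\<mu> = "- 1 - lambda_min (graph_compl E)"
  note C = simple_graph_compl[OF E]
  note regC = regular_of_degree_compl[OF E reg]
  have AC: "?A - ?J = 0 - mat 1 - ?C"
    using E by (auto simp: vec_eq_iff adj_matrix_def graph_compl_def mat_def simple_graph_def irreflp_def)
  have symAJ: "transpose (?A - ?J) = ?A - ?J"
    using transpose_adj_matrix[OF E] by (simp add: vec_eq_iff transpose_def)
  have AJ: "(?A - ?J) *v x = l *\<^sub>R x \<longleftrightarrow> ?C *v x = (- 1 - l) *\<^sub>R x" for x l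
  proof -
    have "(?A - ?J) *v x = - x - ?C *v x"
      unfolding AC matrix_vector_mult_diff_rdistrib by simp
    moreover have "- x $ i - (?C *v x) $ i = l * x $ i \<longleftrightarrow> (?C *v x) $ i = (- 1 - l) * x $ i" for i
      by (simp add: left_diff_distrib) linarith
    ultimately show ?thesis
      by (simp add: vec_eq_iff)
  qed
  obtain v where v: "v \<noteq> 0" "?C *v v = lambda_min (graph_compl E) *\<^sub>R v"
      and low: "\<And>x. lambda_min (graph_compl E) * (x \<bullet> x) \<le> x \<bullet> (?C *v x)"
    using lambda_min_eigenvector[OF C] by metis
  let ?P = "proots (charpoly ?A)" and ?Q = "proots (charpoly (?A - ?J))"
  have row: "(\<Sum>j\<in>UNIV. ?A $ i $ j) = real k" for i
    using arg_cong[OF adj_matrix_mult_ones[OF reg], of "\<lambda>v. v $ i"]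
    by (simp add: matrix_vector_mult_def)
  have "proots (charpoly ?A * [:- (real k - ?N), 1:]) = proots ([:- real k, 1:] * charpoly (?A - ?J))"
    by (simp only: charpoly_minus_ones[OF row])
  moreover have "proots (charpoly ?A * [:- (real k - ?N), 1:]) = ?P + proots [:- (real k - ?N), 1:]"
    using charpoly_nonzero[OF transpose_adj_matrix[OF E]] by (intro proots_mult) auto
  moreover have "proots ([:- real k, 1:] * charpoly (?A - ?J)) = proots [:- real k, 1:] + ?Q"
    using charpoly_nonzero[OF symAJ] by (intro proots_mult) auto
  ultimately have PQ: "add_mset (real k - ?N) ?P = add_mset (real k) ?Q"
    by (simp only: proots_linear_factor) simp
  have "real k \<noteq> real k - ?N"
    by simp
  then have P: "?P = add_mset (real k) (?Q - {#real k - ?N#})"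
    using PQ by (metis add_eq_conv_diff add_mset_remove_trivial diff_union_swap)
  have setQ: "set_mset ?Q = {x. \<exists>v. v \<noteq> 0 \<and> ?C *v v = (- 1 - x) *\<^sub>R v}"
    by (simp only: set_proots_charpoly[OF symAJ] AJ)
  have "?\<mu> \<in># ?Q"
    using v by (auto simp: setQ)
  \<comment> \<open>The complement has an edge, so \<open>?\<mu>\<close> is nonnegative, while
    \<open>k - N\<close> is negative; the deleted root is a different one.\<close>
  moreover have "?\<mu> \<noteq> real k - ?N"
    using lambda_min_le_minus_one[OF C nonadj] regC(2) by (auto simp flip: of_nat_diff)
  ultimately have "?\<mu> \<in># ?Q - {#real k - ?N#}"
    by (simp add: in_diff_count)
  moreover have "x \<le> ?\<mu>" if "x \<in># ?Q - {#real k - ?N#}" for x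
    using in_diffD[OF that] eigenvalue_ge[OF low] by (fastforce simp: setQ)
  moreover have "x \<le> real k" if "x \<in># ?Q - {#real k - ?N#}" for x
  proof -
    have "x \<in># ?P"
      unfolding P using that by simp
    then show ?thesis
      using regular_eigenvalue_le[OF reg] by (auto simp: set_proots_charpoly[OF transpose_adj_matrix[OF E]])
  qed
  ultimately show ?thesis
    unfolding lambda2_def using P by (intro eigvals_nth_1)
qed

section \<open>Automorphism groups and averaging\<close>

definition automorphisms :: "('v \<Rightarrow> 'v \<Rightarrow> bool) \<Rightarrow> ('v \<Rightarrow> 'v) set" where
  "automorphisms E = {f. bij f \<and> (\<forall>x y. E (f x) (f y) \<longleftrightarrow> E x y)}"

definition arc_transitive :: "('v \<Rightarrow> 'v \<Rightarrow> bool) \<Rightarrow> bool" where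
  "arc_transitive E \<longleftrightarrow>
     (\<forall>x y x' y'. E x y \<longrightarrow> E x' y' \<longrightarrow> (\<exists>f\<in>automorphisms E. f x = x' \<and> f y = y'))"

lemma id_automorphism: "id \<in> automorphisms E"
  by (simp add: automorphisms_def)

lemma comp_automorphism: "f \<in> automorphisms E \<Longrightarrow> g \<in> automorphisms E \<Longrightarrow> f \<circ> g \<in> automorphisms E"
  by (auto simp: automorphisms_def intro: bij_comp)

lemma inv_automorphism: "f \<in> automorphisms E \<Longrightarrow> inv f \<in> automorphisms E"
  by (simp add: automorphisms_def bij_imp_bij_inv) (metis bij_inv_eq_iff)

text \<open>Composition with \<open>f\<close> on the right permutes the group; composition with
  \<open>inv f\<close> undoes it.\<close>

lemma sum_automorphisms_invariant:
  assumes f: "f \<in> automorphisms E"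
  shows "(\<Sum>g\<in>automorphisms E. h (g \<circ> f)) = (\<Sum>g\<in>automorphisms E. h g)"
proof (rule sum.reindex_bij_witness[where i = "\<lambda>g. g \<circ> inv f" and j = "\<lambda>g. g \<circ> f"])
  have "bij f"
    using f by (simp add: automorphisms_def)
  then have "f \<circ> inv f = id" "inv f \<circ> f = id"
    unfolding surj_iff[symmetric] inj_iff[symmetric] by (simp_all add: bij_is_inj bij_is_surj)
  then show "g \<circ> f \<circ> inv f = g" "g \<circ> inv f \<circ> f = g" for g :: "'a \<Rightarrow> 'a"
    by (simp_all add: comp_assoc)
qed (use f in \<open>auto intro: comp_automorphism inv_automorphism\<close>)

text \<open>The quadratic form is a sum of squares, one for each member of \<open>F\<close>.\<close>

lemma gram_psd_on: "psd_on UNIV (\<lambda>i j. \<Sum>f\<in>F. u f i * u f j)" for u :: "'f \<Rightarrow> 'v::finite \<Rightarrow> real"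
  unfolding psd_on_def
proof (intro conjI ballI allI)
  fix x :: "'v \<Rightarrow> real"
  have "(\<Sum>i\<in>UNIV. \<Sum>j\<in>UNIV. (\<Sum>f\<in>F. u f i * u f j) * x i * x j) =
      (\<Sum>i\<in>UNIV. \<Sum>j\<in>UNIV. \<Sum>f\<in>F. (u f i * x i) * (u f j * x j))"
    by (simp add: sum_distrib_left mult_ac)
  also have "\<dots> = (\<Sum>i\<in>UNIV. \<Sum>f\<in>F. \<Sum>j\<in>UNIV. (u f i * x i) * (u f j * x j))"
    by (intro sum.cong refl sum.swap)
  also have "\<dots> = (\<Sum>f\<in>F. \<Sum>i\<in>UNIV. \<Sum>j\<in>UNIV. (u f i * x i) * (u f j * x j))"
    by (rule sum.swap)
  also have "\<dots> = (\<Sum>f\<in>F. (\<Sum>i\<in>UNIV. u f i * x i)\<^sup>2)"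
    by (simp only: power2_eq_square sum_product)
  finally show "0 \<le> (\<Sum>i\<in>UNIV. \<Sum>j\<in>UNIV. (\<Sum>f\<in>F. u f i * u f j) * x i * x j)"
    by (simp add: sum_nonneg)
qed (simp add: mult.commute)

lemma psd_on_add_const_scale:
  fixes P :: "'v::finite \<Rightarrow> 'v \<Rightarrow> real"
  assumes "psd_on UNIV P" "a \<ge> 0" "b \<ge> 0"
  shows "psd_on UNIV (\<lambda>i j. a + b * P i j)"
  unfolding psd_on_def
proof (intro conjI ballI allI)
  fix x :: "'v \<Rightarrow> real"
  have "(\<Sum>i\<in>UNIV. \<Sum>j\<in>UNIV. (a + b * P i j) * x i * x j) =
      a * (\<Sum>i\<in>UNIV. \<Sum>j\<in>UNIV. x i * x j) + b * (\<Sum>i\<in>UNIV. \<Sum>j\<in>UNIV. P i j * x i * x j)"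
    by (simp add: sum_distrib_left sum.distrib[symmetric] algebra_simps)
  also have "(\<Sum>i\<in>UNIV. \<Sum>j\<in>UNIV. x i * x j) = (\<Sum>i\<in>UNIV. x i)\<^sup>2"
    by (simp only: power2_eq_square sum_product)
  finally show "0 \<le> (\<Sum>i\<in>UNIV. \<Sum>j\<in>UNIV. (a + b * P i j) * x i * x j)"
    using assms by (simp add: psd_on_def)
next
  show "a + b * P i j = a + b * P j i" for i j
    using assms by (auto simp: psd_on_def)
qed

section \<open>Theta function of arc-transitive graphs and their complements\<close>

theorem arc_transitive_lovasz_theta:
  fixes E :: "'v::finite \<Rightarrow> 'v \<Rightarrow> bool"
  assumes E: "simple_graph E" and reg: "regular_of_degree E k" and arc: "arc_transitive E"
    and ab: "E a b"
  shows "lovasz_theta E = - (real CARD('v) * lambda_min E) / (real k - lambda_min E)"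
    and "lovasz_theta (graph_compl E) = 1 - real k / lambda_min E"
proof -
  let ?N = "real CARD('v)" and ?A = "adj_matrix E" and ?F = "automorphisms E"
  define l where "l = lambda_min E"
  have l: "l \<le> - 1"
    using lambda_min_le_minus_one[OF E ab] by (simp add: l_def)
  have k: "k > 0"
    using reg ab unfolding regular_of_degree_def by (metis card_gt_0_iff empty_Collect_eq finite)
  define q where "q = real k / l"
  have q: "q < 0"
    using k l by (simp add: q_def divide_pos_neg)
  obtain v where v: "v \<noteq> 0" "?A *v v = l *\<^sub>R v" and low: "\<And>x. l * (x \<bullet> x) \<le> x \<bullet> (?A *v x)"
    using lambda_min_eigenvector[OF E] unfolding l_def by metis
  have sumv: "(\<Sum>i\<in>UNIV. v $ i) = 0"
    using regular_eigenvector_sum[OF E reg v(2)] l by simp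
  have sym: "E i j \<longleftrightarrow> E j i" and irr: "\<not> E i i" for i j
    using E by (auto simp: simple_graph_def symp_def irreflp_def)
  have deg: "real (card {y. E x y}) = real k" for x
    using reg by (simp add: regular_of_degree_def)
  have ex_nbr: "\<exists>y. E x y" for x
    using reg k by (metis card.empty card_gt_0_iff empty_Collect_eq less_irrefl regular_of_degree_def)

  have "?N / (1 - q) \<in> theta_values E"
  proof (rule theta_value_of_gram)
    let ?M = "\<lambda>i j. if i = j then 1 else if E i j then - 1 / l else 0 :: real"
    have M: "?M i j = (if i = j then 1 else 0) - ?A $ i $ j / l" for i j
      using irr by (simp add: adj_matrix_def)
    \<comment> \<open>The form is \<open>y \<bullet> y - (y \<bullet> (A *v y)) / l\<close>.
      Dividing the Rayleigh bound by the negative number \<open>l\<close> reverses it, which makes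
      this nonnegative.\<close>
    show "psd_on UNIV ?M"
      unfolding psd_on_def
    proof (intro conjI ballI allI)
      fix x :: "'v \<Rightarrow> real"
      define y :: "real ^ 'v" where "y = (\<chi> i. x i)"
      have "(\<Sum>i\<in>UNIV. \<Sum>j\<in>UNIV. ?M i j * x i * x j) =
          (\<Sum>i\<in>UNIV. x i * x i - (\<Sum>j\<in>UNIV. x i * (?A $ i $ j * x j)) / l)"
      proof (intro sum.cong refl)
        fix i
        have "?M i j * x i * x j = (if i = j then x i * x j else 0) - x i * (?A $ i $ j * x j) / l" for j
          unfolding M by (simp add: left_diff_distrib)
        then show "(\<Sum>j\<in>UNIV. ?M i j * x i * x j) = x i * x i - (\<Sum>j\<in>UNIV. x i * (?A $ i $ j * x j)) / l"
          by (simp add: sum_subtractf sum_divide_distrib)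
      qed
      also have "\<dots> = y \<bullet> y - (y \<bullet> (?A *v y)) / l"
        by (simp add: y_def inner_vec_def matrix_vector_mult_def sum_subtractf sum_distrib_left sum_divide_distrib)
      also have "\<dots> \<ge> 0"
        using low[of y] l by (simp add: field_simps)
      finally show "0 \<le> (\<Sum>i\<in>UNIV. \<Sum>j\<in>UNIV. ?M i j * x i * x j)" .
    qed (simp add: sym)
    show "(\<Sum>j\<in>UNIV. ?M i j) = 1 - q" for i
      unfolding M using deg[of i]
      by (simp add: sum_subtractf sum_divide_distrib[symmetric] adj_matrix_def sum.If_cases q_def)
  qed (use q in auto)

  moreover have "1 - q \<in> theta_values (graph_compl E)"
  proof -
    \<comment> \<open>The average is kept as a plain sum over the group; division by
      \<open>P a a\<close> normalizes it later.\<close>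
    define P where "P i j = (\<Sum>f\<in>?F. v $ f i * v $ f j)" for i j
    have P_inv: "P (f i) (f j) = P i j" if "f \<in> ?F" for f i j
      unfolding P_def using sum_automorphisms_invariant[OF that, of "\<lambda>g. v $ g i * v $ g j"] by simp
    \<comment> \<open>Every vertex starts an arc because \<open>k > 0\<close>, so arc-transitivity
      also moves \<open>a\<close> to any vertex.\<close>
    have P_diag: "P i i = P a a" for i
    proof -
      obtain j where "E i j"
        using ex_nbr by blast
      then obtain f where "f \<in> ?F" "f a = i"
        using arc ab unfolding arc_transitive_def by blast
      then show ?thesis
        using P_inv by metis
    qed
    have P_edge: "P i j = P a b" if "E i j" for i j
      using arc ab that P_inv unfolding arc_transitive_def by metis
    have vf: "(\<Sum>j | E i j. v $ f j) = l * v $ f i" if "f \<in> ?F" for f i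
    proof -
      have f: "bij f" "\<And>x y. E (f x) (f y) \<longleftrightarrow> E x y"
        using that by (auto simp: automorphisms_def)
      have inv: "E i (inv f j) \<longleftrightarrow> E (f i) j" for j
        using f(2)[of i "inv f j"] f(1) by (simp add: bij_is_surj surj_f_inv_f)
      have "(\<Sum>j | E i j. v $ f j) = (\<Sum>j | E (f i) j. v $ j)"
        by (rule sum.reindex_bij_witness[where i = "inv f" and j = f])
          (use f in \<open>auto simp: inv bij_is_inj bij_is_surj surj_f_inv_f\<close>)
      also have "\<dots> = l * v $ f i"
        using arg_cong[OF v(2), of "\<lambda>x. x $ f i"] by (simp add: adj_matrix_mult_vec)
      finally show ?thesis .
    qed
    \<comment> \<open>Row \<open>a\<close> of \<open>P\<close> is summed over the neighbours of
      \<open>a\<close> in two ways: by constancy on edges, and by the eigenvalue equation, which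
      each \<open>v $ f j\<close> satisfies by \<open>vf\<close>. This fixes the edge entries at
      \<open>P a a / q\<close>.\<close>
    have "real k * P a b = (\<Sum>j | E a j. P a j)"
      using P_edge deg[of a] by simp
    also have "\<dots> = (\<Sum>f\<in>?F. v $ f a * (\<Sum>j | E a j. v $ f j))"
      unfolding P_def by (subst sum.swap) (simp add: sum_distrib_left)
    also have "\<dots> = l * P a a"
      by (simp add: vf P_def sum_distrib_left algebra_simps)
    finally have kP: "real k * P a b = l * P a a" .
    have sumf: "(\<Sum>i\<in>UNIV. h (f i)) = (\<Sum>i\<in>UNIV. h i)" if "f \<in> ?F" for f and h :: "'v \<Rightarrow> real"
      using sum.reindex_bij_betw[of f UNIV UNIV h] that by (simp add: automorphisms_def)
    have P_row: "(\<Sum>j\<in>UNIV. P i j) = 0" for i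
      unfolding P_def by (subst sum.swap) (simp add: sum_distrib_left[symmetric] sumf sumv)
    \<comment> \<open>The trace of \<open>P\<close> is the group order times
      \<open>v \<bullet> v\<close>; the identity makes the group nonempty.\<close>
    have "?N * P a a = (\<Sum>i::'v\<in>UNIV. P a a)"
      by simp
    also have "\<dots> = (\<Sum>i\<in>UNIV. P i i)"
      by (intro sum.cong refl P_diag[symmetric])
    also have "\<dots> = (\<Sum>f\<in>?F. v \<bullet> v)"
      unfolding P_def by (subst sum.swap) (simp add: sumf[where h = "\<lambda>i. v $ i * v $ i"] inner_vec_def)
    also have "\<dots> > 0"
      using v(1) id_automorphism[of E] by (auto simp: card_gt_0_iff intro!: mult_pos_pos)
    finally have Paa: "P a a > 0"
      by (simp add: zero_less_mult_iff)
    \<comment> \<open>Both weights are nonnegative because \<open>q < 0\<close>. They give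
      \<open>1\<close> on the diagonal, and \<open>0\<close> on the edges of \<open>E\<close>, where
      \<open>P i j / P a a = 1 / q\<close>.\<close>
    define M where "M i j = 1 / (1 - q) + (- q / (1 - q) / P a a) * P i j" for i j
    have M_alt: "M i j = (1 - q * (P i j / P a a)) / (1 - q)" for i j
      unfolding M_def by (simp add: diff_divide_distrib)
    have "?N / (?N / (1 - q)) \<in> theta_values (graph_compl E)"
    proof (rule theta_value_of_gram)
      show "psd_on UNIV M"
        unfolding M_def
      proof (rule psd_on_add_const_scale)
        show "psd_on UNIV P"
          using gram_psd_on[of "\<lambda>f i. v $ f i" ?F] by (simp add: P_def[abs_def])
        show "0 \<le> 1 / (1 - q)"
          using q by simp
        show "0 \<le> - q / (1 - q) / P a a"
          using q Paa by (intro divide_nonneg_pos) auto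
      qed
      show "M i i = 1" for i
        using Paa q by (simp add: M_alt P_diag[of i])
      show "M i j = 0" if "i \<noteq> j" "\<not> graph_compl E i j" for i j
      proof -
        have "P i j = P a b"
          using that by (intro P_edge) (auto simp: graph_compl_def)
        also have "\<dots> = P a a / q"
          using kP k l by (simp add: q_def field_simps)
        finally show ?thesis
          using Paa q by (simp add: M_alt)
      qed
      show "(\<Sum>j\<in>UNIV. M i j) = ?N / (1 - q)" for i
        unfolding M_def sum.distrib sum_distrib_left[symmetric] P_row by simp
      show "?N / (1 - q) > 0"
        using q by simp
    qed
    then show ?thesis
      by simp
  qed

  ultimately have "lovasz_theta E = ?N / (1 - q)" "lovasz_theta (graph_compl E) = 1 - q"
    using q by (auto intro!: lovasz_theta_eqI)
  moreover have "?N / (1 - q) = - (?N * l) / (real k - l)"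
    using l by (simp add: q_def field_simps)
  ultimately show "lovasz_theta E = - (?N * lambda_min E) / (real k - lambda_min E)"
    "lovasz_theta (graph_compl E) = 1 - real k / lambda_min E"
    by (simp_all add: q_def l_def)
qed

text \<open>The preceding theorem is applied to the complement, whose degree is
  \<open>CARD('v) - 1 - k\<close> and whose least eigenvalue is \<open>- 1 - lambda2 E\<close>; its
  two formulas exchange roles.\<close>

theorem arc_transitive_compl_lovasz_theta:
  fixes E :: "'v::finite \<Rightarrow> 'v \<Rightarrow> bool"
  assumes E: "simple_graph E" and reg: "regular_of_degree E k"
    and arc: "arc_transitive (graph_compl E)" and ab: "graph_compl E a b"
  shows "lovasz_theta E = (real CARD('v) - real k + lambda2 E) / (1 + lambda2 E)"
    and "lovasz_theta (graph_compl E) =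
      real CARD('v) * (1 + lambda2 E) / (real CARD('v) - real k + lambda2 E)"
proof -
  note C = simple_graph_compl[OF E]
  note regC = regular_of_degree_compl[OF E reg]
  have l: "lambda_min (graph_compl E) = - 1 - lambda2 E"
    using lambda2_eq[OF E reg ab] by simp
  have "lambda2 E \<ge> 0"
    using lambda_min_le_minus_one[OF C ab] l by simp
  moreover have "real (CARD('v) - 1 - k) = real CARD('v) - 1 - real k"
    using regC(2) by (simp add: of_nat_diff)
  ultimately have "1 - real (CARD('v) - 1 - k) / lambda_min (graph_compl E) =
        (real CARD('v) - real k + lambda2 E) / (1 + lambda2 E)"
      and "- (real CARD('v) * lambda_min (graph_compl E)) / (real (CARD('v) - 1 - k) - lambda_min (graph_compl E)) =
        real CARD('v) * (1 + lambda2 E) / (real CARD('v) - real k + lambda2 E)"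
    unfolding l by (simp_all add: divide_simps) (simp_all add: algebra_simps)
  then show "lovasz_theta E = (real CARD('v) - real k + lambda2 E) / (1 + lambda2 E)"
    "lovasz_theta (graph_compl E) =
      real CARD('v) * (1 + lambda2 E) / (real CARD('v) - real k + lambda2 E)"
    using arc_transitive_lovasz_theta[OF C regC(1) arc ab] by (simp_all add: graph_compl_compl[OF E])
qed

subsection \<open>Generalized Hamming graphs\<close>

lemma automorphisms_compl: "f \<in> automorphisms E \<Longrightarrow> f \<in> automorphisms (graph_compl E)"
  by (auto simp: automorphisms_def graph_compl_def bij_def inj_eq)

text \<open>Translations move the tails of both arcs to \<open>0\<close>. The stabilizer of
  \<open>0\<close> then carries one head to the other by way of the reference point
  \<open>a\<close>, through \<open>g \<circ> inv f\<close>.\<close>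

lemma arc_transitiveI:
  fixes E :: "'g::ab_group_add \<Rightarrow> 'g \<Rightarrow> bool"
  assumes trans: "\<And>x y z. E (x + z) (y + z) \<longleftrightarrow> E x y"
    and stab: "\<And>b. E 0 b \<Longrightarrow> \<exists>f\<in>automorphisms E. f 0 = 0 \<and> f a = b"
  shows "arc_transitive E"
  unfolding arc_transitive_def
proof (intro allI impI)
  fix x y x' y' assume xy: "E x y" and xy': "E x' y'"
  have shift: "(\<lambda>u. u + z) \<in> automorphisms E" for z
  proof -
    have "bij (\<lambda>u. u + z)"
      by (rule o_bij[of "\<lambda>u. u - z"]) (auto simp: fun_eq_iff)
    then show ?thesis
      using trans by (simp add: automorphisms_def)
  qed
  have "E 0 (y - x)" "E 0 (y' - x')"
    using trans[of x "- x" y] trans[of x' "- x'" y'] xy xy' by simp_all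
  then obtain f g where f: "f \<in> automorphisms E" "f 0 = 0" "f a = y - x"
    and g: "g \<in> automorphisms E" "g 0 = 0" "g a = y' - x'"
    using stab by meson
  have "inj f"
    using f(1) by (auto simp: automorphisms_def bij_is_inj)
  then have "inv f 0 = 0" "inv f (y - x) = a"
    using f(2,3) by (metis inv_f_f)+
  then have "((\<lambda>u. u + x') \<circ> g \<circ> inv f \<circ> (\<lambda>u. u + - x)) x = x'"
    "((\<lambda>u. u + x') \<circ> g \<circ> inv f \<circ> (\<lambda>u. u + - x)) y = y'"
    using g by simp_all
  moreover have "(\<lambda>u. u + x') \<circ> g \<circ> inv f \<circ> (\<lambda>u. u + - x) \<in> automorphisms E"
    using f(1) g(1) by (intro comp_automorphism inv_automorphism shift)
  ultimately show "\<exists>h\<in>automorphisms E. h x = x' \<and> h y = y'"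
    by blast
qed

section \<open>Hamming spheres and the degree\<close>

lemma hamming_dist_eq_0_iff: "hamming_dist x y = 0 \<longleftrightarrow> x = y"
  by (simp add: hamming_dist_def vec_eq_iff)

lemma hamming_dist_0_left: "hamming_dist 0 x = card {j. x $ j \<noteq> 0}"
  by (simp add: hamming_dist_def eq_commute[of 0])

lemma hamming_dist_add:
  fixes x y z :: "'a::ab_group_add ^ 'n"
  shows "hamming_dist (x + z) (y + z) = hamming_dist x y"
  by (simp add: hamming_dist_def)

lemma gen_hamming_graph_add: "gen_hamming_graph d (x + z) (y + z) \<longleftrightarrow> gen_hamming_graph d x y"
  by (simp add: gen_hamming_graph_def hamming_dist_add)

lemma gen_hamming_graph_compl_add:
  "graph_compl (gen_hamming_graph d) (x + z) (y + z) \<longleftrightarrow> graph_compl (gen_hamming_graph d) x y"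
  by (simp add: graph_compl_def gen_hamming_graph_add)

lemmas gen_hamming_arc_transitiveI =
  arc_transitiveI[where E = "gen_hamming_graph d" for d, OF gen_hamming_graph_add]

lemmas gen_hamming_compl_arc_transitiveI =
  arc_transitiveI[where E = "graph_compl (gen_hamming_graph d)" for d, OF gen_hamming_graph_compl_add]

text \<open>The words form a product set: each coordinate in \<open>S\<close> avoids one value, and
  every other coordinate is forced.\<close>

lemma card_hamming_support:
  fixes x :: "'a::finite ^ 'n"
  shows "card {y. {j. x $ j \<noteq> y $ j} = S} = (CARD('a) - 1) ^ card S"
proof -
  let ?T = "\<lambda>j. if j \<in> S then - {x $ j} else {x $ j}"
  have "bij_betw vec_lambda (PiE UNIV ?T) {y. {j. x $ j \<noteq> y $ j} = S}"
  proof (rule bij_betwI[of _ _ _ vec_nth])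
    have "y $ j \<in> ?T j \<longleftrightarrow> (x $ j \<noteq> y $ j \<longleftrightarrow> j \<in> S)" for y :: "'a ^ 'n" and j
      by (simp add: eq_commute[of "y $ j"])
    then have "{j. x $ j \<noteq> y $ j} = S \<longleftrightarrow> (\<forall>j. y $ j \<in> ?T j)" for y
      by (simp only: set_eq_iff mem_Collect_eq)
    then show "vec_lambda \<in> PiE UNIV ?T \<rightarrow> {y. {j. x $ j \<noteq> y $ j} = S}"
      "vec_nth \<in> {y. {j. x $ j \<noteq> y $ j} = S} \<rightarrow> PiE UNIV ?T"
      by (simp_all add: Pi_iff PiE_iff)
  qed (simp_all add: vec_lambda_inverse)
  from bij_betw_same_card[OF this] have "card {y. {j. x $ j \<noteq> y $ j} = S} = (\<Prod>j\<in>UNIV. card (?T j))"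
    by (simp add: card_PiE)
  also have "\<dots> = (\<Prod>j\<in>UNIV. if j \<in> S then CARD('a) - 1 else 1)"
    by (intro prod.cong) (auto simp: Compl_eq_Diff_UNIV card_Diff_subset)
  also have "\<dots> = (CARD('a) - 1) ^ card S"
    by (simp add: prod.If_cases)
  finally show ?thesis .
qed

lemma card_hamming_sphere:
  fixes x :: "'a::finite ^ 'n"
  shows "card {y. hamming_dist x y = i} = (CARD('n) choose i) * (CARD('a) - 1) ^ i"
proof -
  have "{y. hamming_dist x y = i} = (\<Union>S\<in>{S. S \<subseteq> UNIV \<and> card S = i}. {y. {j. x $ j \<noteq> y $ j} = S})"
    by (auto simp: hamming_dist_def)
  also have "card \<dots> = (\<Sum>S\<in>{S. S \<subseteq> UNIV \<and> card S = i}. card {y. {j. x $ j \<noteq> y $ j} = S})"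
    by (rule card_UN_disjoint) auto
  also have "\<dots> = (\<Sum>S\<in>{S::'n set. S \<subseteq> UNIV \<and> card S = i}. (CARD('a) - 1) ^ i)"
    by (intro sum.cong) (auto simp: card_hamming_support)
  finally show ?thesis
    using n_subsets[of "UNIV :: 'n set" i] by simp
qed

lemma gen_hamming_graph_regular:
  "regular_of_degree (gen_hamming_graph d :: ('a::{field,finite}) ^ 'n \<Rightarrow> _)
     (\<Sum>i = 1..d - 1. (CARD('n) choose i) * (CARD('a) - 1) ^ i)"
  unfolding regular_of_degree_def
proof
  fix x :: "'a ^ 'n"
  have "gen_hamming_graph d x y \<longleftrightarrow> hamming_dist x y \<in> {1..d - 1}" for y
    unfolding gen_hamming_graph_def hamming_dist_eq_0_iff[symmetric] by auto
  then have "{y. gen_hamming_graph d x y} = (\<Union>i\<in>{1..d - 1}. {y. hamming_dist x y = i})"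
    by blast
  also have "card \<dots> = (\<Sum>i = 1..d - 1. card {y. hamming_dist x y = i})"
    by (rule card_UN_disjoint) auto
  finally show "card {y. gen_hamming_graph d x y} = (\<Sum>i = 1..d - 1. (CARD('n) choose i) * (CARD('a) - 1) ^ i)"
    by (simp add: card_hamming_sphere)
qed

section \<open>Hamming isometries over an arbitrary finite field\<close>

lemma bij_if_inj_finite: "inj f \<Longrightarrow> bij f" for f :: "'b::finite \<Rightarrow> 'b"
  by (simp add: bij_def finite_UNIV_inj_surj)

lemma hamming_isometry_automorphism:
  fixes f :: "('a::{field,finite}) ^ 'n \<Rightarrow> 'a ^ 'n"
  assumes "\<And>x y. hamming_dist (f x) (f y) = hamming_dist x y"
  shows "f \<in> automorphisms (gen_hamming_graph d)"
proof -
  have eq: "f x = f y \<longleftrightarrow> x = y" for x y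
    using assms hamming_dist_eq_0_iff by metis
  then have "bij f"
    by (intro bij_if_inj_finite injI) simp
  then show ?thesis
    by (simp add: automorphisms_def gen_hamming_graph_def assms eq)
qed

text \<open>Monomial matrices are isometries: nonzero factors preserve the set of differing
  positions, and \<open>p\<close> only relabels it.\<close>

lemma monomial_automorphism:
  fixes c :: "'n::finite \<Rightarrow> 'a::{field,finite}"
  assumes "bij p" "\<And>j. c j \<noteq> 0"
  shows "(\<lambda>x. \<chi> j. c j * x $ p j) \<in> automorphisms (gen_hamming_graph d :: 'a ^ 'n \<Rightarrow> _)"
proof (rule hamming_isometry_automorphism)
  fix x y :: "'a ^ 'n"
  have "{j. c j * x $ p j \<noteq> c j * y $ p j} = p -` {j. x $ j \<noteq> y $ j}"
    using assms by auto
  also have "card \<dots> = card {j. x $ j \<noteq> y $ j}"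
    using assms(1) by (intro card_vimage_inj) (auto simp: bij_def)
  finally show "hamming_dist (\<chi> j. c j * x $ p j) (\<chi> j. c j * y $ p j) = hamming_dist x y"
    by (simp only: hamming_dist_def vec_lambda_beta)
qed

lemma arc_transitive_hamming:
  "arc_transitive (gen_hamming_graph 2 :: ('a::{field,finite}) ^ 'n \<Rightarrow> _)"
proof (rule gen_hamming_arc_transitiveI)
  fix b :: "'a ^ 'n" assume "gen_hamming_graph 2 0 b"
  then have "hamming_dist 0 b = 1"
    using hamming_dist_eq_0_iff[of 0 b] by (auto simp: gen_hamming_graph_def)
  then obtain i where i: "{j. b $ j \<noteq> 0} = {i}"
    by (auto simp: hamming_dist_0_left card_1_singleton_iff)
  \<comment> \<open>\<open>undefined\<close> is an arbitrary but fixed coordinate, whose unit vector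
    is the reference neighbour of \<open>0\<close>. Swapping it with \<open>i\<close> and scaling by
    \<open>b $ i\<close> reaches \<open>b\<close>.\<close>
  define p where "p = Transposition.transpose (undefined :: 'n) i"
  let ?f = "\<lambda>x. \<chi> j. b $ i * x $ p j"
  have "b $ i \<noteq> 0"
    using i by auto
  then have "?f \<in> automorphisms (gen_hamming_graph 2)"
    by (intro monomial_automorphism) (simp_all add: p_def)
  moreover have "?f 0 = 0"
    by (simp add: vec_eq_iff)
  moreover have "?f (axis undefined 1) = b"
    using i by (auto simp: vec_eq_iff axis_def p_def Transposition.transpose_def)
  ultimately show "\<exists>f\<in>automorphisms (gen_hamming_graph 2). f 0 = 0 \<and> f (axis undefined 1) = b"
    by (intro bexI[of _ ?f]) auto
qed

text \<open>The words at distance \<open>n\<close> from \<open>0\<close> have no zero entry, so the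
  diagonal matrix with entries \<open>b $ j\<close> is an isometry that takes the all-ones word to
  \<open>b\<close>.\<close>

lemma arc_transitive_compl_full_distance:
  "arc_transitive (graph_compl (gen_hamming_graph CARD('n) :: ('a::{field,finite}) ^ 'n \<Rightarrow> _))"
proof (rule gen_hamming_compl_arc_transitiveI)
  fix b :: "'a ^ 'n" assume "graph_compl (gen_hamming_graph CARD('n)) 0 b"
  then have "CARD('n) \<le> card {j. b $ j \<noteq> 0}"
    by (auto simp: graph_compl_def gen_hamming_graph_def hamming_dist_0_left)
  then have "{j. b $ j \<noteq> 0} = UNIV"
    by (intro card_seteq) auto
  then have "(\<lambda>x. \<chi> j. b $ j * x $ id j) \<in> automorphisms (gen_hamming_graph CARD('n))"
    by (intro monomial_automorphism bij_id) auto
  from automorphisms_compl[OF this]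
  show "\<exists>f\<in>automorphisms (graph_compl (gen_hamming_graph CARD('n))). f 0 = 0 \<and> f 1 = b"
    by (rule bexI[rotated]) (simp add: vec_eq_iff)
qed

section \<open>Words over the two-element field and the parity bit\<close>

lemma binary_cases:
  assumes "CARD('a::{field,finite}) = 2"
  shows "(x::'a) = 0 \<or> x = 1"
proof -
  have "{0, 1 :: 'a} = UNIV"
    using assms by (intro card_seteq) auto
  then show ?thesis
    by blast
qed

lemma binary_add_self:
  assumes "CARD('a::{field,finite}) = 2"
  shows "(x::'a) + x = 0"
proof -
  have "(1::'a) + 1 = 0"
    using binary_cases[OF assms, of "1 + 1"] by (metis add_cancel_right_right zero_neq_one)
  then show ?thesis
    using binary_cases[OF assms, of x] by auto
qed

lemma binary_of_nat_eq_0_iff: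
  assumes "CARD('a::{field,finite}) = 2"
  shows "(of_nat m :: 'a) = 0 \<longleftrightarrow> even m"
proof -
  have "(of_nat m :: 'a) = (if even m then 0 else 1)"
    using binary_add_self[OF assms, of 1] by (induction m) auto
  then show ?thesis
    by simp
qed

definition indicator_vec :: "'n set \<Rightarrow> ('a::zero_neq_one) ^ 'n" where
  "indicator_vec S = (\<chi> j. if j \<in> S then 1 else 0)"

lemma binary_eq_indicator_vec:
  assumes "CARD('a::{field,finite}) = 2"
  shows "x = indicator_vec {j. (x :: 'a ^ 'n) $ j \<noteq> 0}"
  using binary_cases[OF assms] by (auto simp: vec_eq_iff indicator_vec_def)

lemma support_indicator_vec: "{j. indicator_vec S $ j \<noteq> (0 :: 'a::zero_neq_one)} = S"
  by (simp add: indicator_vec_def)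

lemma hamming_dist_0_indicator_vec: "hamming_dist 0 (indicator_vec S) = card S"
  by (simp add: hamming_dist_def indicator_vec_def)

lemma indicator_vec_eq_0_iff: "indicator_vec S = 0 \<longleftrightarrow> S = {}"
  by (auto simp: vec_eq_iff indicator_vec_def)

text \<open>
  Appending the parity bit \<open>\<Sum>k. x $ k\<close> embeds \<open>\<F>\<^sub>2\<^sup>n\<close> into the even-weight words of length
  \<open>n + 1\<close>; exchanging coordinate \<open>i\<close> with the parity bit gives the following map.
\<close>

definition parity_swap :: "'n \<Rightarrow> ('a::comm_monoid_add) ^ 'n \<Rightarrow> 'a ^ 'n" where
  "parity_swap i x = (\<chi> j. if j = i then (\<Sum>k\<in>UNIV. x $ k) else x $ j)"

text \<open>The Hamming weight of the word extended by its parity bit.\<close>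

definition parity_weight :: "('a::comm_monoid_add) ^ 'n \<Rightarrow> nat" where
  "parity_weight x = card {j. x $ j \<noteq> 0} + (if (\<Sum>k\<in>UNIV. x $ k) \<noteq> 0 then 1 else 0)"

lemma binary_sum:
  assumes "CARD('a::{field,finite}) = 2"
  shows "(\<Sum>k\<in>UNIV. x $ k) = (of_nat (card {j. (x :: 'a ^ 'n) $ j \<noteq> 0}) :: 'a)"
proof -
  have "(\<Sum>k\<in>UNIV. x $ k) = (\<Sum>k\<in>UNIV. if x $ k \<noteq> 0 then 1 else 0)"
    using binary_cases[OF assms] by (intro sum.cong) auto
  then show ?thesis
    by (simp add: sum.If_cases del: if_not_P)
qed

lemma even_parity_weight:
  assumes "CARD('a::{field,finite}) = 2"
  shows "even (parity_weight (x :: 'a ^ 'n))"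
  by (simp add: parity_weight_def binary_sum[OF assms] binary_of_nat_eq_0_iff[OF assms])

text \<open>Every coordinate other than \<open>i\<close> occurs twice and cancels in characteristic
  two. The new parity bit is thus the old coordinate \<open>i\<close>, so the map is a true
  exchange.\<close>

lemma sum_parity_swap:
  fixes x :: "('a::{field,finite}) ^ 'n"
  assumes "CARD('a) = 2"
  shows "(\<Sum>k\<in>UNIV. parity_swap i x $ k) = x $ i"
proof -
  have "(\<Sum>k\<in>UNIV. parity_swap i x $ k) = (\<Sum>k\<in>UNIV. x $ k) + (\<Sum>k\<in>UNIV - {i}. x $ k)"
    by (subst sum.remove[of _ i]) (auto simp: parity_swap_def)
  also have "(\<Sum>k\<in>UNIV. x $ k) = x $ i + (\<Sum>k\<in>UNIV - {i}. x $ k)"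
    by (simp add: sum.remove[of _ i])
  finally show ?thesis
    using binary_add_self[OF assms] by (simp add: add.assoc)
qed

lemma parity_swap_parity_swap:
  fixes x :: "('a::{field,finite}) ^ 'n"
  assumes "CARD('a) = 2"
  shows "parity_swap i (parity_swap i x) = x"
  using sum_parity_swap[OF assms, of i x] by (simp add: vec_eq_iff parity_swap_def)

lemma parity_weight_parity_swap:
  fixes x :: "('a::{field,finite}) ^ 'n"
  assumes "CARD('a) = 2"
  shows "parity_weight (parity_swap i x) = parity_weight x"
proof -
  have card: "card {j. y $ j \<noteq> 0} = (if y $ i \<noteq> 0 then 1 else 0) + card {j. j \<noteq> i \<and> y $ j \<noteq> 0}" for y :: "'a ^ 'n"
  proof (cases "y $ i = 0")
    case True
    then have "{j. y $ j \<noteq> 0} = {j. j \<noteq> i \<and> y $ j \<noteq> 0}"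
      by auto
    with True show ?thesis
      by simp
  next
    case False
    then have "{j. y $ j \<noteq> 0} = insert i {j. j \<noteq> i \<and> y $ j \<noteq> 0}"
      by auto
    with False show ?thesis
      by simp
  qed
  have "{j. j \<noteq> i \<and> parity_swap i x $ j \<noteq> 0} = {j. j \<noteq> i \<and> x $ j \<noteq> 0}"
    by (auto simp: parity_swap_def)
  moreover have "parity_swap i x $ i = (\<Sum>k\<in>UNIV. x $ k)"
    by (simp add: parity_swap_def)
  ultimately show ?thesis
    unfolding parity_weight_def sum_parity_swap[OF assms] card[of x] card[of "parity_swap i x"] by simp
qed

text \<open>The extended weight of \<open>x - y\<close> is the distance or one more, and it is even.
  For odd \<open>d\<close> it is therefore below \<open>d\<close> exactly when the distance is, and
  the additive map \<open>parity_swap i\<close> preserves it.\<close>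

lemma parity_swap_automorphism:
  assumes q: "CARD('a::{field,finite}) = 2" and d: "odd d"
  shows "parity_swap i \<in> automorphisms (gen_hamming_graph d :: 'a ^ 'n \<Rightarrow> _)"
proof -
  have dist: "hamming_dist x y < d \<longleftrightarrow> parity_weight (x - y) < d" for x y :: "'a ^ 'n"
  proof -
    have "hamming_dist x y = card {j. (x - y) $ j \<noteq> 0}"
      by (simp add: hamming_dist_def)
    then have "parity_weight (x - y) = hamming_dist x y \<or> parity_weight (x - y) = Suc (hamming_dist x y)"
      by (simp add: parity_weight_def)
    moreover have "parity_weight (x - y) \<noteq> d"
      using even_parity_weight[OF q, of "x - y"] d by auto
    ultimately show ?thesis
      by auto
  qed
  have diff: "parity_swap i x - parity_swap i y = parity_swap i (x - y)" for x y :: "'a ^ 'n"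
    by (simp add: vec_eq_iff parity_swap_def sum_subtractf)
  have inj: "inj (parity_swap i :: 'a ^ 'n \<Rightarrow> _)"
    by (rule inj_on_inverseI[of _ "parity_swap i"]) (rule parity_swap_parity_swap[OF q])
  then show ?thesis
    by (simp add: automorphisms_def gen_hamming_graph_def bij_if_inj_finite inj_eq dist diff
        parity_weight_parity_swap[OF q])
qed

lemma parity_swap_indicator_vec:
  assumes q: "CARD('a::{field,finite}) = 2"
  shows "parity_swap i (indicator_vec S :: 'a ^ 'n) =
    indicator_vec (if odd (card S) then insert i S else S - {i})"
  using binary_sum[OF q, of "indicator_vec S :: 'a ^ 'n"] binary_of_nat_eq_0_iff[OF q, of "card S"]
    binary_cases[OF q, of "of_nat (card S)"]
  by (auto simp: vec_eq_iff parity_swap_def support_indicator_vec) (auto simp: indicator_vec_def)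

lemma parity_swap_0: "parity_swap i 0 = 0"
  by (simp add: vec_eq_iff parity_swap_def)

text \<open>The neighbours of \<open>0\<close> have weight 1 or 2, hence all have extended weight 2;
  parity swaps fix \<open>0\<close> and fuse them into one orbit.\<close>

lemma arc_transitive_binary_distance_2:
  assumes q: "CARD('a::{field,finite}) = 2"
  shows "arc_transitive (gen_hamming_graph 3 :: 'a ^ 'n \<Rightarrow> _)"
proof (rule gen_hamming_arc_transitiveI)
  let ?i = "undefined :: 'n" and ?v = "indicator_vec :: 'n set \<Rightarrow> 'a ^ 'n"
  let ?G = "gen_hamming_graph 3 :: 'a ^ 'n \<Rightarrow> _"
  note swap = parity_swap_automorphism[OF q, of 3, simplified]
  \<comment> \<open>Two parity swaps replace \<open>?i\<close> by \<open>i\<close>: the first turns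
    the support \<open>{?i}\<close> into \<open>{i, ?i}\<close>, the second removes
    \<open>?i\<close>.\<close>
  have single: "\<exists>f\<in>automorphisms ?G. f 0 = 0 \<and> f (?v {?i}) = ?v {i}" for i
  proof (cases "i = ?i")
    case True
    then show ?thesis
      by (intro bexI[of _ id]) (auto simp: id_automorphism)
  next
    case False
    have "parity_swap i (?v {?i}) = ?v {i, ?i}"
      by (simp add: parity_swap_indicator_vec[OF q])
    moreover have "parity_swap ?i (?v {i, ?i}) = ?v {i}"
      using False by (auto simp: parity_swap_indicator_vec[OF q] intro!: arg_cong[of _ _ ?v])
    ultimately show ?thesis
      by (intro bexI[of _ "parity_swap ?i \<circ> parity_swap i"] comp_automorphism swap) (simp add: parity_swap_0)
  qed
  fix b :: "'a ^ 'n" assume b: "?G 0 b"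
  obtain S where S: "b = ?v S"
    using binary_eq_indicator_vec[OF q] by metis
  have "card S = 1 \<or> card S = 2"
    using b card_gt_0_iff[of S]
    by (auto simp: S gen_hamming_graph_def hamming_dist_0_indicator_vec indicator_vec_eq_0_iff
        eq_commute[of 0 "?v S"])
  then show "\<exists>f\<in>automorphisms ?G. f 0 = 0 \<and> f (?v {?i}) = b"
  proof
    assume "card S = 1"
    then show ?thesis
      using single unfolding S by (auto simp: card_1_singleton_iff)
  next
    assume "card S = 2"
    then obtain i j where ij: "S = {i, j}" "i \<noteq> j"
      by (meson card_2_iff)
    obtain f where f: "f \<in> automorphisms ?G" "f 0 = 0" "f (?v {?i}) = ?v {j}"
      using single by blast
    have "parity_swap i (?v {j}) = ?v S"
      by (simp add: parity_swap_indicator_vec[OF q] ij)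
    then show ?thesis
      using f by (intro bexI[of _ "parity_swap i \<circ> f"] comp_automorphism swap) (simp_all add: parity_swap_0 S)
  qed
qed

text \<open>Words at distance at least \<open>n - 1\<close> from \<open>0\<close> lack at most one
  coordinate. Evenness of \<open>n\<close> serves twice: it makes \<open>n - 1\<close> odd, so that
  parity swaps are automorphisms, and it gives the all-ones word parity \<open>0\<close>, so that
  \<open>parity_swap i\<close> deletes coordinate \<open>i\<close>.\<close>

lemma arc_transitive_compl_binary:
  assumes q: "CARD('a::{field,finite}) = 2" and n: "even CARD('n)"
  shows "arc_transitive (graph_compl (gen_hamming_graph (CARD('n) - 1) :: 'a ^ 'n \<Rightarrow> _))"
proof (rule gen_hamming_compl_arc_transitiveI)
  let ?v = "indicator_vec :: 'n set \<Rightarrow> 'a ^ 'n"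
  let ?G = "graph_compl (gen_hamming_graph (CARD('n) - 1) :: 'a ^ 'n \<Rightarrow> _)"
  have "odd (CARD('n) - 1)"
    using n by simp
  note swap = automorphisms_compl[OF parity_swap_automorphism[OF q this]]
  fix b :: "'a ^ 'n" assume b: "?G 0 b"
  obtain S where S: "b = ?v S"
    using binary_eq_indicator_vec[OF q] by metis
  have "CARD('n) - 1 \<le> card S"
    using b by (auto simp: S graph_compl_def gen_hamming_graph_def hamming_dist_0_indicator_vec)
  moreover have "card (- S) = CARD('n) - card S"
    by (simp add: Compl_eq_Diff_UNIV card_Diff_subset)
  ultimately have "card (- S) \<le> 1"
    by simp
  then consider "- S = {}" | i where "- S = {i}"
    by (metis card_0_eq card_1_singletonE finite le_Suc_eq le_zero_eq One_nat_def)
  then show "\<exists>f\<in>automorphisms ?G. f 0 = 0 \<and> f (?v UNIV) = b"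
  proof cases
    case 1
    then have "S = UNIV"
      by auto
    then show ?thesis
      by (intro bexI[of _ id]) (auto simp: id_automorphism S)
  next
    case (2 i)
    then have "S = UNIV - {i}"
      by auto
    then have "parity_swap i (?v UNIV) = b"
      using n by (simp add: parity_swap_indicator_vec[OF q] S)
    then show ?thesis
      by (intro bexI[of _ "parity_swap i"] swap) (simp add: parity_swap_0)
  qed
qed

text \<open>Differing in every coordinate means being the antipode \<open>x + 1\<close>, so the
  graph is the complement of a perfect matching.\<close>

lemma binary_antipodal_graph_iff:
  fixes x y :: "('a::{field,finite}) ^ 'n"
  assumes q: "CARD('a) = 2"
  shows "gen_hamming_graph CARD('n) x y \<longleftrightarrow> y \<noteq> x \<and> y \<noteq> x + 1"
proof -
  have "hamming_dist x y < CARD('n) \<longleftrightarrow> {j. x $ j \<noteq> y $ j} \<noteq> UNIV"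
    unfolding hamming_dist_def by (metis finite less_irrefl psubsetI psubset_card_mono subset_UNIV)
  also have "\<dots> \<longleftrightarrow> (\<exists>j. y $ j \<noteq> x $ j + 1)"
  proof -
    have "(2::'a) = 0"
      using binary_add_self[OF q, of 1] by simp
    then have "x $ j \<noteq> y $ j \<longleftrightarrow> y $ j = x $ j + 1" for j
      using binary_cases[OF q, of "x $ j"] binary_cases[OF q, of "y $ j"] by (elim disjE) simp_all
    then show ?thesis
      by blast
  qed
  also have "\<dots> \<longleftrightarrow> y \<noteq> x + 1"
    by (simp add: vec_eq_iff)
  finally show ?thesis
    by (auto simp: gen_hamming_graph_def)
qed

text \<open>Every bijection that commutes with the antipodal map is an automorphism. Exchanging the
  pairs of \<open>a\<close> and \<open>b\<close> is one, and it fixes \<open>0\<close>; when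
  \<open>b = a + 1\<close> the pairs coincide and a single transposition serves.\<close>

lemma arc_transitive_binary_antipodal:
  assumes q: "CARD('a::{field,finite}) = 2"
  shows "arc_transitive (gen_hamming_graph CARD('n) :: 'a ^ 'n \<Rightarrow> _)"
proof -
  let ?G = "gen_hamming_graph CARD('n) :: 'a ^ 'n \<Rightarrow> _"
  have add1: "x + 1 + 1 = x" for x :: "'a ^ 'n"
    using binary_add_self[OF q, of 1] by (simp add: vec_eq_iff add.assoc)
  have add1_eq: "x + 1 = y \<longleftrightarrow> x = y + 1" for x y :: "'a ^ 'n"
    using add1 by metis
  have aut: "f \<in> automorphisms ?G" if "bij f" "\<And>x. f (x + 1) = f x + 1" for f
  proof -
    have "f y = f x \<longleftrightarrow> y = x" for x y
      using that(1) by (simp add: bij_is_inj inj_eq)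
    then show ?thesis
      using that(1) by (simp add: automorphisms_def binary_antipodal_graph_iff[OF q] flip: that(2))
  qed
  have "\<exists>f\<in>automorphisms ?G. f 0 = 0 \<and> f a = b" if "?G 0 a" "?G 0 b" for a b
  proof -
    have ne: "a \<noteq> 0" "a \<noteq> 1" "b \<noteq> 0" "b \<noteq> 1"
      using that by (simp_all add: binary_antipodal_graph_iff[OF q])
    then have ne1: "a + 1 \<noteq> 0" "b + 1 \<noteq> 0"
      using add1[of 0] by (auto simp: add1_eq)
    show ?thesis
    proof (cases "b = a + 1")
      case True
      have "Transposition.transpose a b \<in> automorphisms ?G"
        by (intro aut) (auto simp: True Transposition.transpose_def add1 add1_eq)
      moreover have "Transposition.transpose a b 0 = 0"
        using ne by (simp add: Transposition.transpose_def)
      ultimately show ?thesis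
        by (intro bexI[of _ "Transposition.transpose a b"]) auto
    next
      case False
      let ?f = "Transposition.transpose a b \<circ> Transposition.transpose (a + 1) (b + 1)"
      have "a \<noteq> b + 1"
        using False add1_eq by metis
      have "?f \<in> automorphisms ?G"
        using False \<open>a \<noteq> b + 1\<close> by (intro aut bij_comp bij_transpose) (auto simp: Transposition.transpose_def add1 add1_eq)
      moreover have "?f 0 = 0"
        using ne ne1 by (simp add: Transposition.transpose_def)
      moreover have "?f a = b"
        using False \<open>a \<noteq> b + 1\<close> by (simp add: Transposition.transpose_def)
      ultimately show ?thesis
        by (intro bexI[of _ ?f]) auto
    qed
  qed
  then show ?thesis
        using gen_hamming_arc_transitiveI by (metis arc_transitive_def)
qed

theorem theorem4p7p1:
  fixes G :: "('a::{field,finite}) ^ 'n \<Rightarrow> 'a ^ 'n \<Rightarrow> bool"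
    and q n d \<Delta> :: nat
  assumes "q = CARD('a)" and "n = CARD('n)"
    and "2 \<le> d" and "d \<le> n"
    and "G = gen_hamming_graph d"
    and "\<Delta> = (\<Sum>i = 1..d - 1. (n choose i) * (q - 1) ^ i)"
  shows "regular_of_degree G \<Delta> \<and>
    (d = 2 \<or> (q = 2 \<and> d = 3) \<or> (q = 2 \<and> d = n) \<longrightarrow>
       lovasz_theta G = - (real q ^ n * lambda_min G) / (real \<Delta> - lambda_min G) \<and>
       lovasz_theta (graph_compl G) = 1 - real \<Delta> / lambda_min G) \<and>
    ((q = 2 \<and> d = n - 1 \<and> even n) \<or> d = n \<longrightarrow>
       lovasz_theta G = (real q ^ n - real \<Delta> + lambda2 G) / (1 + lambda2 G) \<and>
       lovasz_theta (graph_compl G) =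
         real q ^ n * (1 + lambda2 G) / (real q ^ n - real \<Delta> + lambda2 G))"
proof -
  have G: "simple_graph G"
    using simple_gen_hamming_graph assms(5) by simp
  have reg: "regular_of_degree G \<Delta>"
    using gen_hamming_graph_regular assms by simp
  have N: "real CARD('a ^ 'n) = real q ^ n"
    using assms by simp
  have "hamming_dist 0 (axis i 1 :: 'a ^ 'n) = 1" for i
    by (simp add: hamming_dist_def axis_def)
  \<comment> \<open>Distance \<open>1\<close> is below \<open>d\<close> because
    \<open>2 \<le> d\<close>.\<close>
  then have edge: "G 0 (axis undefined 1)"
    using hamming_dist_eq_0_iff[of 0 "axis undefined 1 :: 'a ^ 'n"] assms by (simp add: gen_hamming_graph_def)
  \<comment> \<open>The all-ones word differs from \<open>0\<close> everywhere, so its distance is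
    \<open>n\<close>, which is at least \<open>d\<close>.\<close>
  have nonedge: "graph_compl G 0 1"
    using assms by (simp add: graph_compl_def gen_hamming_graph_def hamming_dist_def)
  have "arc_transitive G" if "d = 2 \<or> (q = 2 \<and> d = 3) \<or> (q = 2 \<and> d = n)"
    using that assms arc_transitive_hamming arc_transitive_binary_distance_2 arc_transitive_binary_antipodal
    by auto
  moreover have "arc_transitive (graph_compl G)" if "(q = 2 \<and> d = n - 1 \<and> even n) \<or> d = n"
    using that assms arc_transitive_compl_binary arc_transitive_compl_full_distance by auto
  ultimately show ?thesis
    using reg arc_transitive_lovasz_theta[OF G reg _ edge] arc_transitive_compl_lovasz_theta[OF G reg _ nonedge]
    unfolding N by blast
qed

end
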